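(* Let $n\ge 3$ and let $\chi_n(w,\lambda)=P_n(w^2,\lambda)$. Then $P_n$ (in $\mathbb{C}[t,\lambda]$) and $\chi_n$ (in $\mathbb{C}[w,\lambda]$) have the same generic irreducibility classification for every fixed diagonal vector $a\in\mathbb{C}^n$: for fixed $a$, $\chi_n$ is irreducible for generic $c\in(\mathbb{C}^* )^{n-1}$ if and only if $P_n$ is irreducible for generic $c\in(\mathbb{C}^* )^{n-1}$. More explicitly, for fixed $a$: if $n=2m+1$, then $\chi_n$ is reducible for generic $c$ if and only if $a_1=a_3=\cdots=a_{2m+1}$; if $n=2m\ge 4$, then $\chi_n$ is reducible for generic $c$ if and only if $a_1=a_3=\cdots=a_{2m-1}$ and $a_2=a_4=\cdots=a_{2m}$.
   Context: For $a=(a_1,\dots,a_n)\in\mathbb{C}^n$ and $c=(c_1,\dots,c_{n-1})\in\mathbb{C}^{n-1}$, the reduced continuant $P_n(t,\lambda)\in\mathbb{C}[t,\lambda]$ is defined by $P_0=1$, $P_1=\lambda+a_1$, $P_k=(\lambda+a_k)P_{k-1}-t\,c_{k-1}P_{k-2}$ for $2\le k\le n$. Writing $c_i=b_i^2$, the polynomial $\chi_n(w,\lambda)=P_n(w^2,\lambda)$ equals $\det(J_n(w)+\lambda I)$, where $J_n(w)$ is the symmetric tridiagonal $n\times n$ matrix with diagonal entries $a_1,\dots,a_n$ and off-diagonal entries $wb_1,\dots,wb_{n-1}$. "For generic $c$" means for all $c$ outside a proper Zariski closed subset of $T_c=(\mathbb{C}^* )^{n-1}$. *)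

theory Defs
  imports "HOL-Computational_Algebra.Computational_Algebra" "HOL-Library.FuncSet"
begin

text \<open>
  Bivariate polynomials over the complex numbers are elements of \<open>complex poly poly\<close>: the inner
  variable is \<open>t\<close> (respectively \<open>w\<close>), the outer variable is \<open>\<lambda>\<close>.  Thus \<open>[:[:x:], 1:]\<close> is
  \<open>\<lambda> + x\<close>, and \<open>smult [:0, y:]\<close> is multiplication by \<open>t y\<close>.

  Vectors are functions on \<open>nat\<close> indexed from 1; \<open>continuant a c n\<close> reads only
  \<open>a 1, ..., a n\<close> and \<open>c 1, ..., c (n - 1)\<close>.
\<close>

fun continuant :: "(nat \<Rightarrow> complex) \<Rightarrow> (nat \<Rightarrow> complex) \<Rightarrow> nat \<Rightarrow> complex poly poly" where
  "continuant a c 0 = 1"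
| "continuant a c (Suc 0) = [:[:a 1:], 1:]"
| "continuant a c (Suc (Suc k)) =
     [:[:a (Suc (Suc k)):], 1:] * continuant a c (Suc k)
       - smult [:0, c (Suc k):] (continuant a c k)"

text \<open>The substitution \<open>t = w\<^sup>2\<close>, applied to each coefficient of a power of \<open>\<lambda>\<close>.\<close>

definition chi :: "(nat \<Rightarrow> complex) \<Rightarrow> (nat \<Rightarrow> complex) \<Rightarrow> nat \<Rightarrow> complex poly poly" where
  "chi a c n = map_poly (\<lambda>q. pcompose q (monom 1 2)) (continuant a c n)"

definition torus :: "nat \<Rightarrow> (nat \<Rightarrow> complex) set" where
  "torus n = {1..n - 1} \<rightarrow>\<^sub>E (UNIV - {0})"

text \<open>Polynomial functions in the coordinates indexed by \<open>I\<close>.\<close>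

inductive_set poly_funs :: "nat set \<Rightarrow> ((nat \<Rightarrow> complex) \<Rightarrow> complex) set" for I :: "nat set" where
  const: "(\<lambda>_. k) \<in> poly_funs I"
| coord: "i \<in> I \<Longrightarrow> (\<lambda>x. x i) \<in> poly_funs I"
| add: "f \<in> poly_funs I \<Longrightarrow> g \<in> poly_funs I \<Longrightarrow> (\<lambda>x. f x + g x) \<in> poly_funs I"
| mult: "f \<in> poly_funs I \<Longrightarrow> g \<in> poly_funs I \<Longrightarrow> (\<lambda>x. f x * g x) \<in> poly_funs I"

text \<open>
  The Zariski topology on the torus is induced from affine space, so ordinary (not Laurent)
  polynomials suffice to cut out its closed subsets.
\<close>

definition zariski_closed_in_torus :: "nat \<Rightarrow> (nat \<Rightarrow> complex) set \<Rightarrow> bool" where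
  "zariski_closed_in_torus n Z \<longleftrightarrow>
     (\<exists>F \<subseteq> poly_funs {1..n - 1}. Z = {c \<in> torus n. \<forall>f\<in>F. f c = 0})"

definition for_generic_c :: "nat \<Rightarrow> ((nat \<Rightarrow> complex) \<Rightarrow> bool) \<Rightarrow> bool" where
  "for_generic_c n Q \<longleftrightarrow>
     (\<exists>Z. zariski_closed_in_torus n Z \<and> Z \<noteq> torus n \<and> (\<forall>c \<in> torus n - Z. Q c))"

end

theory Submission
  imports Defs "Subresultants.Subresultant_Gcd" "HOL-Computational_Algebra.Field_as_Ring"
begin

text \<open>
  The continuant belongs to a path with node weights \<open>a\<^sub>i\<close> and edge weights \<open>c\<^sub>i\<close>. At a parameter
  with \<open>c\<^sub>k = 0\<close> the path is cut and the continuant is the product of the continuants of the two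
  parts (\<open>continuant_split\<close>). The proof compares factorizations at such degenerate parameters.

  What allows the comparison is that the type of a factorization specialises
  (\<open>monic_split_closed\<close>): if, for a Zariski dense set of \<open>c\<close>, the polynomial has a monic factor of
  degree \<open>p\<close> in \<open>\<lambda>\<close>, it has one for every \<open>c\<close> in affine space. This is an instance of the
  closedness of finite morphisms: a factorization is determined by the roots of its factors at
  finitely many values of \<open>t\<close>, which are integral over the parameters, and resultants eliminate
  them. It has two consequences. One irreducible member makes the generic member
  irreducible (\<open>generic_irreducible_of_point\<close>), and if all members are reducible, then some
  type \<open>0 < p < n\<close> occurs for all \<open>c\<close> (\<open>dense_reducible_uniform_split\<close>).

  Call a diagonal alternating if it satisfies the condition of the classification. If it
  does not, then for \<open>n \<ge> 4\<close> the path without its first or without its last node has the same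
  property, so by induction an irreducible polynomial of degree \<open>n - 1\<close> divides the continuant
  for some \<open>c\<close>. If all members were reducible, the uniform type would be \<open>1\<close> or \<open>n - 1\<close>, and there
  would be a zero \<open>\<lambda> = g(t)\<close> for every \<open>c\<close>. Parameters that cut the path into blocks of two and three
  nodes show that this forces an alternating diagonal (\<open>exists_irreducible_continuant\<close>).

  If \<open>P\<close> is irreducible, then in a proper factorization of \<open>P(w\<^sup>2, \<lambda>)\<close> both factors have degree
  \<open>n / 2\<close>, by taking norms for \<open>w \<mapsto> - w\<close> (\<open>split_subst_square_of_irreducible\<close>). This settles odd
  \<open>n\<close>. For even \<open>n\<close> the type \<open>n / 2\<close> would occur for all \<open>c\<close>, and cutting off an end node again gives
  a contradiction (\<open>exists_irreducible_chi\<close>).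

  Conversely, for an alternating diagonal an explicit factor exists for every \<open>c\<close>: for odd \<open>n\<close>
  the polynomial \<open>\<lambda> + a\<^sub>1\<close>, and for even \<open>n\<close> a polynomial \<open>(\<lambda> + a\<^sub>1) (\<lambda> + a\<^sub>2) - \<sigma> t\<close>
  (\<open>alternating_imp_reducible_continuant\<close>). Nonempty open subsets of the torus intersect, so generic
  irreducibility and generic reducibility exclude each other.
\<close>

section \<open>Elimination of integral variables\<close>

lemma poly_funs_mono: "f \<in> poly_funs I \<Longrightarrow> I \<subseteq> J \<Longrightarrow> f \<in> poly_funs J"
  by (induction rule: poly_funs.induct) (auto intro: poly_funs.intros)

lemma poly_funs_cong: "f \<in> poly_funs I \<Longrightarrow> (\<And>i. i \<in> I \<Longrightarrow> x i = y i) \<Longrightarrow> f x = f y"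
  by (induction rule: poly_funs.induct) auto

lemma poly_funs_diff: "f \<in> poly_funs I \<Longrightarrow> g \<in> poly_funs I \<Longrightarrow> (\<lambda>x. f x - g x) \<in> poly_funs I"
  using poly_funs.add[of f I "\<lambda>x. (- 1) * g x"] poly_funs.mult[OF poly_funs.const[of "-1"], of g I]
  by simp

lemma poly_funs_sum:
  "(\<And>a. a \<in> A \<Longrightarrow> f a \<in> poly_funs I) \<Longrightarrow> (\<lambda>x. \<Sum>a\<in>A. f a x) \<in> poly_funs I"
  by (induction A rule: infinite_finite_induct) (auto intro: poly_funs.intros)

lemma poly_funs_prod:
  "(\<And>a. a \<in> A \<Longrightarrow> f a \<in> poly_funs I) \<Longrightarrow> (\<lambda>x. \<Prod>a\<in>A. f a x) \<in> poly_funs I"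
  by (induction A rule: infinite_finite_induct) (auto intro: poly_funs.intros)

text \<open>
  Restriction to a line replaces facts on polynomials in many variables by facts on
  univariate polynomials; in particular it shows below that affine space is irreducible.
\<close>

lemma poly_funs_on_line:
  "f \<in> poly_funs I \<Longrightarrow> \<exists>p. \<forall>s. poly p s = f (\<lambda>i. x i + s * (y i - x i))"
proof (induction rule: poly_funs.induct)
  case (const k)
  show ?case by (rule exI[of _ "[:k:]"]) simp
next
  case (coord i)
  show ?case by (rule exI[of _ "[:x i, y i - x i:]"]) simp
next
  case (add f g)
  from add.IH(1) obtain p where p: "\<forall>s. poly p s = f (\<lambda>i. x i + s * (y i - x i))" ..
  from add.IH(2) obtain q where q: "\<forall>s. poly q s = g (\<lambda>i. x i + s * (y i - x i))" ..
  from p q show ?case by (intro exI[of _ "p + q"]) simp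
next
  case (mult f g)
  from mult.IH(1) obtain p where p: "\<forall>s. poly p s = f (\<lambda>i. x i + s * (y i - x i))" ..
  from mult.IH(2) obtain q where q: "\<forall>s. poly q s = g (\<lambda>i. x i + s * (y i - x i))" ..
  from p q show ?case by (intro exI[of _ "p * q"]) simp
qed

lemma poly_funs_common_nonzero:
  assumes "f \<in> poly_funs I" "g \<in> poly_funs I" "f x \<noteq> 0" "g y \<noteq> 0"
  shows "\<exists>z. f z \<noteq> 0 \<and> g z \<noteq> 0"
proof -
  obtain p where p: "\<And>s. poly p s = f (\<lambda>i. x i + s * (y i - x i))"
    using poly_funs_on_line[OF assms(1), of x y] by auto
  obtain q where q: "\<And>s. poly q s = g (\<lambda>i. x i + s * (y i - x i))"
    using poly_funs_on_line[OF assms(2), of x y] by auto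
  have "p \<noteq> 0" using p[of 0] assms(3) by auto
  moreover have "q \<noteq> 0" using q[of 1] assms(4) by auto
  ultimately have "p * q \<noteq> 0" by simp
  then obtain s where "poly (p * q) s \<noteq> 0" using poly_all_0_iff_0 by blast
  then show ?thesis using p q by (metis mult_eq_0_iff poly_mult)
qed

lemma poly_funs_finite_common_nonzero:
  assumes "finite A" "\<And>a. a \<in> A \<Longrightarrow> f a \<in> poly_funs I" "\<And>a. a \<in> A \<Longrightarrow> \<exists>x. f a x \<noteq> 0"
  shows "\<exists>z. \<forall>a\<in>A. f a z \<noteq> 0"
  using assms
proof (induction A rule: finite_induct)
  case (insert a A)
  have "\<exists>z. \<forall>b\<in>A. f b z \<noteq> 0" by (rule insert.IH) (simp_all add: insert.prems)
  then obtain z where z: "\<forall>b\<in>A. f b z \<noteq> 0" ..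
  have "\<exists>x. f a x \<noteq> 0" by (simp add: insert.prems)
  then obtain x where x: "f a x \<noteq> 0" ..
  have "(\<lambda>x. \<Prod>b\<in>A. f b x) \<in> poly_funs I" using insert.prems by (intro poly_funs_prod) auto
  moreover have "(\<Prod>b\<in>A. f b z) \<noteq> 0" using z insert.hyps by simp
  moreover have "f a \<in> poly_funs I" by (rule insert.prems(1)) simp
  ultimately have "\<exists>w. (\<Prod>b\<in>A. f b w) \<noteq> 0 \<and> f a w \<noteq> 0"
    using x by (intro poly_funs_common_nonzero)
  then show ?case using insert.hyps by auto
qed simp

text \<open>
  Density is tested on the whole affine space, not on the torus, so that a conclusion drawn
  from a dense set of parameters also holds where some \<open>c\<^sub>i\<close> vanishes. The whole proof
  lives on these degenerate parameters.
\<close>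

definition zariski_dense :: "nat set \<Rightarrow> (nat \<Rightarrow> complex) set \<Rightarrow> bool" where
  "zariski_dense I D \<longleftrightarrow> (\<forall>f\<in>poly_funs I. (\<forall>x\<in>D. f x = 0) \<longrightarrow> (\<forall>x. f x = 0))"

lemma zariski_denseD:
  "zariski_dense I D \<Longrightarrow> f \<in> poly_funs I \<Longrightarrow> \<forall>x\<in>D. f x = 0 \<Longrightarrow> f x = 0"
  by (simp add: zariski_dense_def)

lemma zariski_dense_UNIV: "zariski_dense I UNIV"
  by (simp add: zariski_dense_def)

text \<open>
  Irreducibility of affine space: nonzero polynomials that vanish on the pieces would have a
  nonzero product that vanishes on the whole union.
\<close>

lemma zariski_dense_finite_Union:
  assumes "zariski_dense I D" "finite A" "D \<subseteq> (\<Union>a\<in>A. E a)"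
  shows "\<exists>a\<in>A. zariski_dense I (E a)"
proof (rule ccontr)
  assume "\<not> ?thesis"
  then have "\<forall>a\<in>A. \<exists>f. f \<in> poly_funs I \<and> (\<forall>x\<in>E a. f x = 0) \<and> (\<exists>x. f x \<noteq> 0)"
    by (simp add: zariski_dense_def Bex_def)
  from bchoice[OF this] obtain f where
    f: "\<forall>a\<in>A. f a \<in> poly_funs I \<and> (\<forall>x\<in>E a. f a x = 0) \<and> (\<exists>x. f a x \<noteq> 0)" ..
  have "\<exists>z. \<forall>a\<in>A. f a z \<noteq> 0"
    by (rule poly_funs_finite_common_nonzero[OF assms(2), of f I]) (simp_all add: f)
  then obtain z where z: "\<forall>a\<in>A. f a z \<noteq> 0" ..
  have "(\<lambda>x. \<Prod>a\<in>A. f a x) \<in> poly_funs I" by (rule poly_funs_prod) (simp add: f)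
  moreover have "\<forall>x\<in>D. (\<Prod>a\<in>A. f a x) = 0"
  proof
    fix x assume "x \<in> D"
    then obtain a where "a \<in> A" "x \<in> E a" using assms(3) by blast
    then have "f a x = 0" using f by simp
    then show "(\<Prod>a\<in>A. f a x) = 0" using \<open>a \<in> A\<close> by (intro prod_zero[OF assms(2)] bexI)
  qed
  ultimately have "(\<Prod>a\<in>A. f a z) = 0" by (rule zariski_denseD[OF assms(1)])
  then show False using z assms(2) by simp
qed

definition coeff_family :: "nat set \<Rightarrow> ((nat \<Rightarrow> complex) \<Rightarrow> complex poly) \<Rightarrow> bool" where
  "coeff_family I p \<longleftrightarrow> (\<exists>d. \<forall>x. degree (p x) \<le> d) \<and> (\<forall>i. (\<lambda>x. coeff (p x) i) \<in> poly_funs I)"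

text \<open>
  A polynomial function in \<open>x\<^sub>k\<close> and the remaining variables is a univariate polynomial in
  \<open>x\<^sub>k\<close> whose coefficients are polynomial functions of the others. The degree bound is uniform
  but need not be attained at every point.
\<close>

lemma poly_funs_isolate_variable:
  assumes "h \<in> poly_funs (insert k I)" "k \<notin> I"
  shows "\<exists>q. coeff_family I q \<and> (\<forall>x y. h (x(k := y)) = poly (q x) y)"
  using assms(1)
proof (induction rule: poly_funs.induct)
  case (const c)
  show ?case
    by (rule exI[of _ "\<lambda>_. [:c:]"]) (auto simp: coeff_family_def intro: poly_funs.const)
next
  case (coord i)
  show ?case
  proof (cases "i = k")
    case True
    then show ?thesis
      by (intro exI[of _ "\<lambda>_. [:0, 1:]"]) (auto simp: coeff_family_def intro!: poly_funs.const exI[of _ 1])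
  next
    case False
    have "(\<lambda>x. coeff [:x i:] j) \<in> poly_funs I" for j
      using coord False by (cases j) (auto intro: poly_funs.intros)
    then show ?thesis using False
      by (intro exI[of _ "\<lambda>x. [:x i:]"]) (auto simp: coeff_family_def)
  qed
next
  case (add f g)
  then obtain p q where p: "coeff_family I p" "\<forall>x y. f (x(k := y)) = poly (p x) y"
    and q: "coeff_family I q" "\<forall>x y. g (x(k := y)) = poly (q x) y" by blast
  obtain d e where de: "\<And>x. degree (p x) \<le> d" "\<And>x. degree (q x) \<le> e"
    using p(1) q(1) unfolding coeff_family_def by blast
  have "degree (p x + q x) \<le> max d e" for x
    by (meson de degree_add_le_max le_trans max.mono)
  then have "coeff_family I (\<lambda>x. p x + q x)"
    using p(1) q(1) unfolding coeff_family_def by (auto intro: poly_funs.add)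
  then show ?case using p(2) q(2) by (intro exI[of _ "\<lambda>x. p x + q x"]) (simp del: fun_upd_apply)
next
  case (mult f g)
  then obtain p q where p: "coeff_family I p" "\<forall>x y. f (x(k := y)) = poly (p x) y"
    and q: "coeff_family I q" "\<forall>x y. g (x(k := y)) = poly (q x) y" by blast
  obtain d e where de: "\<And>x. degree (p x) \<le> d" "\<And>x. degree (q x) \<le> e"
    using p(1) q(1) unfolding coeff_family_def by blast
  have "degree (p x * q x) \<le> d + e" for x
    by (meson de add_mono degree_mult_le le_trans)
  moreover have "(\<lambda>x. coeff (p x * q x) i) \<in> poly_funs I" for i
    using p(1) q(1) unfolding coeff_mult coeff_family_def
    by (intro poly_funs_sum poly_funs.mult) auto
  ultimately have "coeff_family I (\<lambda>x. p x * q x)" unfolding coeff_family_def by blast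
  then show ?case using p(2) q(2) by (intro exI[of _ "\<lambda>x. p x * q x"]) (simp del: fun_upd_apply)
qed

definition monic_coeff_family :: "nat set \<Rightarrow> nat \<Rightarrow> ((nat \<Rightarrow> complex) \<Rightarrow> complex poly) \<Rightarrow> bool" where
  "monic_coeff_family I d p \<longleftrightarrow>
     (\<forall>x. lead_coeff (p x) = 1 \<and> degree (p x) = d) \<and> (\<forall>i. (\<lambda>x. coeff (p x) i) \<in> poly_funs I)"

lemma monic_coeff_familyD:
  assumes "monic_coeff_family I d p"
  shows "lead_coeff (p x) = 1" "degree (p x) = d" "p x \<noteq> 0" "(\<lambda>x. coeff (p x) i) \<in> poly_funs I"
proof -
  have *: "lead_coeff (p x) = 1 \<and> degree (p x) = d"
    using assms unfolding monic_coeff_family_def by blast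
  then show "lead_coeff (p x) = 1" "degree (p x) = d" by blast+
  show "p x \<noteq> 0" using * by (metis leading_coeff_0_iff zero_neq_one)
  show "(\<lambda>x. coeff (p x) i) \<in> poly_funs I"
    using assms unfolding monic_coeff_family_def by blast
qed

lemma resultant_poly_funs:
  assumes "monic_coeff_family I d p" "monic_coeff_family I e q"
  shows "(\<lambda>x. resultant (p x) (q x)) \<in> poly_funs I"
proof -
  have entry: "(\<lambda>x. sylvester_mat_sub d e (p x) (q x) $$ (i, j)) \<in> poly_funs I"
    if "i < d + e" "j < d + e" for i j
  proof -
    note idx = sylvester_mat_sub_index[OF that]
    have "(\<lambda>x. coeff (p x) m) \<in> poly_funs I" "(\<lambda>x. coeff (q x) m) \<in> poly_funs I" for m
      using assms unfolding monic_coeff_family_def by auto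
    then show ?thesis unfolding idx
      by (cases "i < e"; cases "i \<le> j \<and> j - i \<le> d"; cases "i - e \<le> j \<and> j \<le> i")
        (simp_all only: if_True if_False poly_funs.const simp_thms)
  qed
  have "resultant (p x) (q x) = (\<Sum>\<pi> | \<pi> permutes {0..<d + e}.
          signof \<pi> * (\<Prod>i = 0..<d + e. sylvester_mat_sub d e (p x) (q x) $$ (i, \<pi> i)))" for x
    using assms unfolding monic_coeff_family_def resultant_sub resultant_sub_def
    by (auto simp: det_def)
  moreover have "(\<lambda>x. \<Sum>\<pi> | \<pi> permutes {0..<d + e}.
          signof \<pi> * (\<Prod>i = 0..<d + e. sylvester_mat_sub d e (p x) (q x) $$ (i, \<pi> i))) \<in> poly_funs I"
    by (intro poly_funs_sum poly_funs.mult poly_funs.const poly_funs_prod entry)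
      (auto dest: permutes_in_image)
  ultimately show ?thesis by presburger
qed

lemma resultant_complex_eq_0_iff:
  fixes p q :: "complex poly"
  assumes "p \<noteq> 0"
  shows "resultant p q = 0 \<longleftrightarrow> (\<exists>y. poly p y = 0 \<and> poly q y = 0)"
proof
  assume "resultant p q = 0"
  then have "degree (gcd p q) \<noteq> 0" by (simp add: resultant_0_gcd)
  then have "\<not> constant (poly (gcd p q))" by (simp add: constant_degree)
  then obtain y where "poly (gcd p q) y = 0" using fundamental_theorem_of_algebra by blast
  then show "\<exists>y. poly p y = 0 \<and> poly q y = 0"
    by (meson gcd_dvd1 gcd_dvd2 poly_eq_0_iff_dvd dvd_trans)
next
  assume "\<exists>y. poly p y = 0 \<and> poly q y = 0"
  then obtain y where "[:- y, 1:] dvd gcd p q" by (auto simp: poly_eq_0_iff_dvd)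
  moreover have "gcd p q \<noteq> 0" using assms by simp
  ultimately have "degree [:- y, 1:] \<le> degree (gcd p q)" by (rule dvd_imp_degree_le)
  then show "resultant p q = 0" by (simp add: resultant_0_gcd)
qed

text \<open>
  The resultant eliminates \<open>y\<close>. The degree in \<open>y\<close> of \<open>h\<close> may drop at special points, which
  would change the shape of the Sylvester matrix. Adding a high multiple \<open>y\<^sup>e p\<close> of the monic
  polynomial \<open>p\<close> makes the second argument monic of constant degree and does not change its
  values at the roots of \<open>p\<close>.
\<close>

lemma eliminate_variable:
  assumes p: "monic_coeff_family I d p" and h: "h \<in> poly_funs (insert k I)" and k: "k \<notin> I"
  shows "\<exists>N\<in>poly_funs I. \<forall>x. N x = 0 \<longleftrightarrow> (\<exists>y. poly (p x) y = 0 \<and> h (x(k := y)) = 0)"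
proof -
  obtain q where q: "coeff_family I q" and hq: "\<And>x y. h (x(k := y)) = poly (q x) y"
    using poly_funs_isolate_variable[OF h k] by blast
  obtain e where e: "\<And>x. degree (q x) \<le> e" using q unfolding coeff_family_def by blast
  note pd = monic_coeff_familyD(1,2)[OF p] and p0 = monic_coeff_familyD(3)[OF p]
  define r where "r x = q x + monom 1 (Suc e) * p x" for x
  have deg: "degree (monom 1 (Suc e) * p x) = Suc e + d" for x
    using pd[of x] p0[of x] by (simp add: degree_mult_eq degree_monom_eq monom_eq_0_iff)
  have degr: "degree (r x) = Suc e + d" for x
    unfolding r_def using e[of x] deg[of x] by (subst degree_add_eq_right) auto
  have "lead_coeff (r x) = 1" for x
  proof -
    have "lead_coeff (r x) = lead_coeff (monom 1 (Suc e) * p x)"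
      unfolding r_def using e[of x] deg[of x] by (intro lead_coeff_add_le) simp
    also have "\<dots> = lead_coeff (monom 1 (Suc e)) * lead_coeff (p x)" by (rule lead_coeff_mult)
    also have "\<dots> = 1" by (metis lead_coeff_monom mult_1 pd(1))
    finally show ?thesis .
  qed
  moreover have "(\<lambda>x. coeff (r x) i) \<in> poly_funs I" for i
  proof -
    have "coeff (r x) i = coeff (q x) i + (if i < Suc e then 0 else coeff (p x) (i - Suc e))" for x
      unfolding r_def by (simp add: coeff_monom_mult)
    then show ?thesis using p q unfolding monic_coeff_family_def coeff_family_def
      by (cases "i < Suc e") (auto intro: poly_funs.add)
  qed
  ultimately have r: "monic_coeff_family I (Suc e + d) r"
    using degr unfolding monic_coeff_family_def by (intro conjI allI)
  have "resultant (p x) (r x) = 0 \<longleftrightarrow> (\<exists>y. poly (p x) y = 0 \<and> h (x(k := y)) = 0)" for x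
  proof -
    have "poly (r x) y = h (x(k := y))" if "poly (p x) y = 0" for y
      unfolding hq r_def using that by (simp only: poly_add poly_mult mult_zero_right add_0_right)
    then show ?thesis unfolding resultant_complex_eq_0_iff[OF p0] by metis
  qed
  then show ?thesis
    by (intro bexI[OF _ resultant_poly_funs[OF p r]]) simp
qed

lemma monic_coeff_family_cong:
  assumes "monic_coeff_family I d p" "\<And>i. i \<in> I \<Longrightarrow> x i = y i"
  shows "p x = p y"
  using assms poly_funs_cong[of "\<lambda>x. coeff (p x) _" I x y] 
  by (intro poly_eqI) (auto simp: monic_coeff_family_def)

definition root_choices ::
  "(nat \<Rightarrow> (nat \<Rightarrow> complex) \<Rightarrow> complex poly) \<Rightarrow> nat set \<Rightarrow> (nat \<Rightarrow> complex) \<Rightarrow> (nat \<Rightarrow> complex) set" where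
  "root_choices r X x = {y. (\<forall>i. i \<notin> X \<longrightarrow> y i = x i) \<and> (\<forall>k\<in>X. poly (r k x) (y k) = 0)}"

lemma eliminate_variables:
  assumes "finite X" "X \<inter> I = {}" "\<And>k. k \<in> X \<Longrightarrow> monic_coeff_family I d (r k)"
    "h \<in> poly_funs (I \<union> X)"
  shows "\<exists>N\<in>poly_funs I. \<forall>x. N x = 0 \<longleftrightarrow> (\<exists>y\<in>root_choices r X x. h y = 0)"
  using assms
proof (induction X arbitrary: h rule: finite_induct)
  case empty
  have "root_choices r {} x = {x}" for x by (auto simp: root_choices_def)
  then show ?case using empty by auto
next
  case (insert k X)
  have "monic_coeff_family (I \<union> X) d (r k)"
    using insert.prems(2)[of k] unfolding monic_coeff_family_def by (auto intro: poly_funs_mono)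
  moreover have "h \<in> poly_funs (insert k (I \<union> X))" using insert.prems(3) by simp
  moreover have "k \<notin> I \<union> X" using insert.hyps insert.prems by auto
  ultimately obtain M where M: "M \<in> poly_funs (I \<union> X)"
    "\<And>x. M x = 0 \<longleftrightarrow> (\<exists>y. poly (r k x) y = 0 \<and> h (x(k := y)) = 0)"
    using eliminate_variable[of "I \<union> X" d "r k" h k] by blast
  obtain N where N: "N \<in> poly_funs I" "\<And>x. N x = 0 \<longleftrightarrow> (\<exists>y\<in>root_choices r X x. M y = 0)"
    using insert.IH[OF _ _ M(1)] insert.prems by auto
  have rk: "r k y = r k x" if "y \<in> root_choices r X x" for x y
    using that insert.prems(1) 
    by (intro monic_coeff_family_cong[OF insert.prems(2)]) (auto simp: root_choices_def)
  have "(\<exists>y\<in>root_choices r X x. M y = 0) \<longleftrightarrow> (\<exists>y\<in>root_choices r (insert k X) x. h y = 0)" for x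
  proof
    assume "\<exists>y\<in>root_choices r X x. M y = 0"
    then obtain y z where y: "y \<in> root_choices r X x" "poly (r k y) z = 0" "h (y(k := z)) = 0"
      using M(2) by blast
    have "y(k := z) \<in> root_choices r (insert k X) x"
      using y rk[OF y(1)] insert.hyps by (auto simp: root_choices_def)
    then show "\<exists>y\<in>root_choices r (insert k X) x. h y = 0" using y by blast
  next
    assume "\<exists>y\<in>root_choices r (insert k X) x. h y = 0"
    then obtain y where y: "y \<in> root_choices r (insert k X) x" "h y = 0" by blast
    have *: "y(k := x k) \<in> root_choices r X x"
      using y insert.hyps by (auto simp: root_choices_def)
    have "poly (r k (y(k := x k))) (y k) = 0" unfolding rk[OF *]
      using y by (auto simp: root_choices_def)
    moreover have "h ((y(k := x k))(k := y k)) = 0" using y by simp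
    ultimately have "M (y(k := x k)) = 0" using M(2) by blast
    then show "\<exists>y\<in>root_choices r X x. M y = 0" using * by blast
  qed
  then show ?case using N by auto
qed

lemma finite_root_choices:
  assumes "finite X" "\<And>k. k \<in> X \<Longrightarrow> r k x \<noteq> 0"
  shows "finite (root_choices r X x)"
proof -
  have "finite (Pi\<^sub>E X (\<lambda>k. {y. poly (r k x) y = 0}))"
    using assms by (intro finite_PiE) (auto simp: poly_roots_finite)
  moreover have "root_choices r X x \<subseteq>
      (\<lambda>f i. if i \<in> X then f i else x i) ` Pi\<^sub>E X (\<lambda>k. {y. poly (r k x) y = 0})"
  proof
    fix y assume y: "y \<in> root_choices r X x"
    have "y = (\<lambda>i. if i \<in> X then restrict y X i else x i)"
      using y by (auto simp: root_choices_def)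
    moreover have "restrict y X \<in> Pi\<^sub>E X (\<lambda>k. {y. poly (r k x) y = 0})"
      using y by (auto simp: root_choices_def)
    ultimately show "y \<in> (\<lambda>f i. if i \<in> X then f i else x i) ` Pi\<^sub>E X (\<lambda>k. {y. poly (r k x) y = 0})"
      by blast
  qed
  ultimately show ?thesis using finite_surj by blast
qed

text \<open>
  Over an infinite field a finite set of points none of which is a common zero of \<open>H\<close> is avoided
  by the zero set of a single combination of members of \<open>H\<close>. A system of equations is thus
  reduced to one equation.
\<close>

lemma generic_combination:
  assumes "finite S" "H \<subseteq> poly_funs J" "\<And>y. y \<in> S \<Longrightarrow> \<exists>h\<in>H. h y \<noteq> 0"
  shows "\<exists>g\<in>poly_funs J. (\<forall>y\<in>S. g y \<noteq> 0) \<and> (\<forall>y. (\<forall>h\<in>H. h y = 0) \<longrightarrow> g y = 0)"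
  using assms(1,3)
proof (induction S rule: finite_induct)
  case empty
  show ?case by (rule bexI[of _ "\<lambda>_. 0"]) (auto intro: poly_funs.const)
next
  case (insert z S)
  have "\<exists>g\<in>poly_funs J. (\<forall>y\<in>S. g y \<noteq> 0) \<and> (\<forall>y. (\<forall>h\<in>H. h y = 0) \<longrightarrow> g y = 0)"
    by (intro insert.IH insert.prems) simp
  then obtain g where g: "g \<in> poly_funs J" "\<forall>y\<in>S. g y \<noteq> 0"
    "\<forall>y. (\<forall>h\<in>H. h y = 0) \<longrightarrow> g y = 0"
    by (elim bexE conjE)
  have "\<exists>h\<in>H. h z \<noteq> 0" by (intro insert.prems) simp
  then obtain h where h: "h \<in> H" "h z \<noteq> 0" ..
  have "\<not> finite (UNIV :: complex set)" by (simp add: infinite_UNIV_char_0)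
  then obtain u where u: "u \<notin> (\<lambda>y. - g y / h y) ` insert z S"
    using insert.hyps by (meson ex_new_if_finite finite.insertI finite_imageI)
  have "g y + u * h y \<noteq> 0" if "y \<in> insert z S" for y
  proof (cases "h y = 0")
    case True
    then show ?thesis using that g h by auto
  next
    case False
    have "u \<noteq> - g y / h y" using u that by blast
    then have "u * h y \<noteq> - g y" using False by (metis eq_divide_imp)
    then show ?thesis by (metis add.inverse_unique)
  qed
  moreover have "(\<lambda>y. g y + u * h y) \<in> poly_funs J"
    using g h assms(2) by (intro poly_funs.add poly_funs.mult poly_funs.const) auto
  ultimately show ?case using g h by (intro bexI[of _ "\<lambda>y. g y + u * h y"]) auto
qed

text \<open>
  Images under finite morphisms are closed, in the form used here: if a polynomial system in
  unknowns that are integral over the parameters is solvable on a dense set of parameters, it is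
  solvable for all of them. At a point without solution a single combination \<open>g\<close> of the equations
  is nonzero at all the finitely many candidates. Eliminating the unknowns from \<open>g\<close> gives a
  polynomial in the parameters that vanishes on the dense set, hence everywhere, but not at that
  point.
\<close>

theorem integral_system_solvable_everywhere:
  assumes X: "finite X" "X \<inter> I = {}" and r: "\<And>k. k \<in> X \<Longrightarrow> monic_coeff_family I d (r k)"
    and H: "H \<subseteq> poly_funs (I \<union> X)" and D: "zariski_dense I D"
    and sol: "\<And>x. x \<in> D \<Longrightarrow> \<exists>y\<in>root_choices r X x. \<forall>h\<in>H. h y = 0"
  shows "\<exists>y\<in>root_choices r X x. \<forall>h\<in>H. h y = 0"
proof (rule ccontr)
  assume no: "\<not> ?thesis"
  have "finite (root_choices r X x)"
    using X r by (intro finite_root_choices monic_coeff_familyD(3))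
  moreover have "\<exists>h\<in>H. h y \<noteq> 0" if "y \<in> root_choices r X x" for y
    using no that by simp
  ultimately have "\<exists>g\<in>poly_funs (I \<union> X). (\<forall>y\<in>root_choices r X x. g y \<noteq> 0) \<and>
      (\<forall>y. (\<forall>h\<in>H. h y = 0) \<longrightarrow> g y = 0)"
    by (intro generic_combination[OF _ H])
  then obtain g where g: "g \<in> poly_funs (I \<union> X)" "\<forall>y\<in>root_choices r X x. g y \<noteq> 0"
    "\<forall>y. (\<forall>h\<in>H. h y = 0) \<longrightarrow> g y = 0"
    by (elim bexE conjE)
  have "\<exists>N\<in>poly_funs I. \<forall>x. N x = 0 \<longleftrightarrow> (\<exists>y\<in>root_choices r X x. g y = 0)"
    by (rule eliminate_variables[OF X _ g(1)]) (rule r)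
  then obtain N where N: "N \<in> poly_funs I" "\<forall>x. N x = 0 \<longleftrightarrow> (\<exists>y\<in>root_choices r X x. g y = 0)"
    by (elim bexE)
  have "\<forall>x\<in>D. N x = 0"
  proof
    fix x assume "x \<in> D"
    from sol[OF this] obtain y where "y \<in> root_choices r X x" "\<forall>h\<in>H. h y = 0" ..
    then show "N x = 0" using g(3) N(2) by auto
  qed
  then have "N x = 0" by (rule zariski_denseD[OF D N(1)])
  then have "\<exists>y\<in>root_choices r X x. g y = 0" using N(2) by simp
  then show False using g(2) by auto
qed

section \<open>Closedness of the splitting locus\<close>

definition eval_inner :: "complex \<Rightarrow> complex poly poly \<Rightarrow> complex poly" where
  "eval_inner s P = map_poly (\<lambda>q. poly q s) P"

lemma coeff_eval_inner: "coeff (eval_inner s P) i = poly (coeff P i) s"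
  by (simp add: eval_inner_def coeff_map_poly)

lemma eval_inner_mult: "eval_inner s (P * Q) = eval_inner s P * eval_inner s Q"
  by (rule poly_eqI) (simp add: coeff_eval_inner coeff_mult poly_sum)

lemma monic_eval_inner:
  assumes "lead_coeff P = 1"
  shows "degree (eval_inner s P) = degree P" "lead_coeff (eval_inner s P) = 1"
proof -
  have "coeff (eval_inner s P) (degree P) = 1" using assms by (simp add: coeff_eval_inner)
  moreover have "degree (eval_inner s P) \<le> degree P"
    by (rule degree_le) (simp add: coeff_eval_inner coeff_eq_0)
  ultimately show "degree (eval_inner s P) = degree P"
    by (metis le_antisym le_degree zero_neq_one)
  then show "lead_coeff (eval_inner s P) = 1" using assms by (simp add: coeff_eval_inner)
qed

lemma poly_poly_eqI:
  assumes "\<And>s l. poly (eval_inner s P) l = poly (eval_inner s Q) l"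
  shows "P = Q"
proof -
  have "eval_inner s P = eval_inner s Q" for s
    using assms by (simp add: poly_eq_poly_eq_iff[symmetric] fun_eq_iff)
  then have "poly (coeff P i) s = poly (coeff Q i) s" for i s
    by (metis coeff_eval_inner)
  then have "coeff P i = coeff Q i" for i by (simp add: poly_eq_poly_eq_iff[symmetric] fun_eq_iff)
  then show ?thesis by (rule poly_eqI)
qed

lemma poly_eval_inner: "poly (eval_inner s P) l = poly (poly P [:l:]) s"
  unfolding eval_inner_def by (induction P) (simp_all add: map_poly_pCons)

text \<open>
  Degrees in the inner variable add up in products. For all but finitely many constants \<open>l\<close> the
  value \<open>F(t, l)\<close> divides the nonzero polynomial \<open>(F G)(t, l)\<close> and so has degree at most \<open>N\<close>.
  Each coefficient of a higher power of \<open>t\<close> in \<open>F\<close> is then a polynomial in \<open>l\<close> with infinitely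
  many zeros.
\<close>

lemma degree_factor_coeff_le:
  fixes F G :: "complex poly poly"
  assumes "F * G \<noteq> 0" "\<And>i. degree (coeff (F * G) i) \<le> N"
  shows "degree (coeff F i) \<le> N"
proof (rule degree_le, intro allI impI)
  fix k assume k: "N < k"
  define S where "S = {l. poly (F * G) [:l:] \<noteq> 0}"
  have "finite {z. poly (F * G) z = 0}" using assms(1) by (rule poly_roots_finite)
  then have "finite ((\<lambda>l::complex. [:l:]) -` {z. poly (F * G) z = 0})"
    by (intro finite_vimageI) (auto simp: inj_on_def)
  then have "finite (- S)" by (simp add: S_def vimage_def Compl_eq)
  then have "infinite S"
    by (metis finite_Un Compl_partition infinite_UNIV_char_0)
  define fk where "fk = map_poly (\<lambda>q. coeff q k) F"
  have fk: "poly fk l = coeff (poly F [:l:]) k" for l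
    unfolding fk_def by (induction F) (simp_all add: map_poly_pCons)
  have "poly fk l = 0" if l: "l \<in> S" for l
  proof -
    have nz: "poly F [:l:] * poly G [:l:] \<noteq> 0" using l by (simp add: S_def)
    have "poly (F * G) [:l:] = (\<Sum>i\<le>degree (F * G). coeff (F * G) i * [:l:] ^ i)"
      by (rule poly_altdef)
    also have "degree \<dots> \<le> N"
    proof (rule degree_sum_le)
      fix i
      have "degree (coeff (F * G) i * [:l:] ^ i) \<le> degree (coeff (F * G) i) + degree ([:l:] ^ i)"
        by (rule degree_mult_le)
      also have "degree ([:l:] ^ i) = 0" by (metis degree_pCons_0 degree_power_le mult_0 le_zero_eq)
      finally show "degree (coeff (F * G) i * [:l:] ^ i) \<le> N" using assms(2)[of i] by simp
    qed simp
    finally have "degree (poly F [:l:] * poly G [:l:]) \<le> N" by simp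
    then have "degree (poly F [:l:]) \<le> N" using nz by (simp add: degree_mult_eq)
    then show ?thesis using k fk by (simp add: coeff_eq_0)
  qed
  then have "S \<subseteq> {l. poly fk l = 0}" by blast
  then have "fk = 0" using \<open>infinite S\<close> poly_roots_finite[of fk] finite_subset by blast
  then have "coeff fk i = 0" by simp
  then show "coeff (coeff F i) k = 0" by (simp add: fk_def coeff_map_poly)
qed

lemma lagrange_basis_exists:
  "\<exists>L :: nat \<Rightarrow> complex poly. \<forall>j\<le>N. degree (L j) \<le> N \<and>
     (\<forall>k\<le>N. poly (L j) (of_nat k) = (if j = k then 1 else 0))"
proof -
  define L :: "nat \<Rightarrow> complex poly" where
    "L j = (\<Prod>k\<in>{..N} - {j}. Polynomial.smult (1 / (of_nat j - of_nat k)) [:- of_nat k, 1:])" for j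
  have "degree (L j) \<le> N" if "j \<le> N" for j
  proof -
    have "degree (L j) \<le> (\<Sum>k\<in>{..N} - {j}. 1)" unfolding L_def
      by (rule order_trans[OF degree_prod_sum_le]) (auto intro!: sum_mono)
    then show ?thesis using that by simp
  qed
  moreover have "poly (L j) (of_nat k) = (if j = k then 1 else 0)" if "j \<le> N" "k \<le> N" for j k
  proof (cases "j = k")
    case True
    then show ?thesis unfolding L_def poly_prod by (auto intro!: prod.neutral simp: diff_divide_distrib[symmetric])
  next
    case False
    then show ?thesis using that unfolding L_def poly_prod by (auto intro!: prod_zero bexI[of _ k])
  qed
  ultimately show ?thesis by (intro exI[of _ L]) simp
qed

definition lagrange_basis :: "nat \<Rightarrow> nat \<Rightarrow> complex poly" where
  "lagrange_basis N = (SOME L. \<forall>j\<le>N. degree (L j) \<le> N \<and>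
     (\<forall>k\<le>N. poly (L j) (of_nat k) = (if j = k then 1 else 0)))"

lemma lagrange_basis:
  assumes "j \<le> N"
  shows "degree (lagrange_basis N j) \<le> N"
    "k \<le> N \<Longrightarrow> poly (lagrange_basis N j) (of_nat k) = (if j = k then 1 else 0)"
proof -
  have "\<forall>j\<le>N. degree (lagrange_basis N j) \<le> N \<and>
      (\<forall>k\<le>N. poly (lagrange_basis N j) (of_nat k) = (if j = k then 1 else 0))"
    unfolding lagrange_basis_def by (rule someI_ex[OF lagrange_basis_exists])
  with assms show "degree (lagrange_basis N j) \<le> N"
    "k \<le> N \<Longrightarrow> poly (lagrange_basis N j) (of_nat k) = (if j = k then 1 else 0)"
    by simp_all
qed

lemma lagrange_interpolation:
  assumes "degree q \<le> N"
  shows "q = (\<Sum>j\<le>N. Polynomial.smult (poly q (of_nat j)) (lagrange_basis N j))"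
proof (rule poly_eqI_degree[of "of_nat ` {..N}"])
  fix x :: complex assume "x \<in> of_nat ` {..N}"
  then obtain k where k: "x = of_nat k" "k \<le> N" by auto
  have "poly (\<Sum>j\<le>N. Polynomial.smult (poly q (of_nat j)) (lagrange_basis N j)) x =
      (\<Sum>j\<le>N. if j = k then poly q (of_nat j) else 0)"
    unfolding poly_sum k(1) using k(2) by (intro sum.cong) (auto simp: lagrange_basis)
  then show "poly q x = poly (\<Sum>j\<le>N. Polynomial.smult (poly q (of_nat j)) (lagrange_basis N j)) x"
    using k by simp
next
  have "card (of_nat ` {..N} :: complex set) = Suc N" by (simp add: card_image inj_on_def)
  moreover have "degree (\<Sum>j\<le>N. Polynomial.smult (poly q (of_nat j)) (lagrange_basis N j)) \<le> N"
    by (intro degree_sum_le) (auto intro: order_trans[OF degree_smult_le] lagrange_basis)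
  ultimately show "degree q < card (of_nat ` {..N} :: complex set)"
    "degree (\<Sum>j\<le>N. Polynomial.smult (poly q (of_nat j)) (lagrange_basis N j)) < card (of_nat ` {..N} :: complex set)"
    using assms by simp_all
qed

text \<open>
  The polynomial in \<open>t\<close> and \<open>\<lambda>\<close>, of degree at most \<open>N\<close> in \<open>t\<close>, that takes the value \<open>u j\<close> at
  \<open>t = j\<close> for \<open>j = 0, ..., N\<close>.
\<close>

definition interpolate :: "nat \<Rightarrow> (nat \<Rightarrow> complex poly) \<Rightarrow> complex poly poly" where
  "interpolate N u = (\<Sum>j\<le>N. Polynomial.smult (lagrange_basis N j) (map_poly (\<lambda>z. [:z:]) (u j)))"

lemma coeff_interpolate:
  "coeff (interpolate N u) i = (\<Sum>j\<le>N. Polynomial.smult (coeff (u j) i) (lagrange_basis N j))"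
  by (simp add: interpolate_def coeff_sum coeff_map_poly mult.commute)

lemma poly_eval_inner_interpolate:
  "poly (eval_inner s (interpolate N u)) l = (\<Sum>j\<le>N. poly (lagrange_basis N j) s * poly (u j) l)"
proof -
  have *: "poly (map_poly (\<lambda>z. [:z:]) q) [:l:] = [:poly q l:]" for q :: "complex poly"
    by (induction q) (simp_all add: map_poly_pCons)
  show ?thesis by (simp add: poly_eval_inner interpolate_def poly_sum * mult.commute)
qed

lemma interpolate_eval_inner:
  assumes "\<And>i. degree (coeff F i) \<le> N"
  shows "interpolate N (\<lambda>j. eval_inner (of_nat j) F) = F"
proof (rule poly_eqI)
  show "coeff (interpolate N (\<lambda>j. eval_inner (of_nat j) F)) i = coeff F i" for i
    unfolding coeff_interpolate coeff_eval_inner by (rule lagrange_interpolation[OF assms, symmetric])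
qed

lemma monic_interpolate:
  assumes "\<And>j. j \<le> N \<Longrightarrow> lead_coeff (u j) = 1" "\<And>j. j \<le> N \<Longrightarrow> degree (u j) = p"
  shows "degree (interpolate N u) = p" "lead_coeff (interpolate N u) = 1"
proof -
  have "coeff (interpolate N u) p = (\<Sum>j\<le>N. Polynomial.smult 1 (lagrange_basis N j))"
    unfolding coeff_interpolate using assms by (intro sum.cong) auto
  also have "\<dots> = 1" using lagrange_interpolation[of 1 N] by simp
  finally have 1: "coeff (interpolate N u) p = 1" .
  have "degree (interpolate N u) \<le> p"
    by (rule degree_le) (simp add: coeff_interpolate coeff_eq_0 assms)
  with 1 show "degree (interpolate N u) = p" by (metis le_antisym le_degree zero_neq_one)
  with 1 show "lead_coeff (interpolate N u) = 1" by simp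
qed

lemma monic_complex_poly_splits:
  fixes q :: "complex poly"
  assumes "lead_coeff q = 1" "finite A" "card A = degree q"
  shows "\<exists>f. q = (\<Prod>i\<in>A. [:- f i, 1:])"
  using assms(2,1,3)
proof (induction A arbitrary: q rule: finite_induct)
  case empty
  then have "degree q = 0" by simp
  then obtain c where "q = [:c:]" by (rule degree_eq_zeroE)
  then show ?case using empty by simp
next
  case (insert a A)
  then have deg: "degree q = Suc (card A)" by simp
  then have "\<not> constant (poly q)" by (simp add: constant_degree)
  then have "\<exists>z. poly q z = 0" by (rule fundamental_theorem_of_algebra)
  then obtain z where "poly q z = 0" ..
  then have "[:- z, 1:] dvd q" by (simp add: poly_eq_0_iff_dvd)
  then obtain r where r: "q = [:- z, 1:] * r" by (rule dvdE)
  have lead: "lead_coeff r = 1" using insert.prems(1) unfolding r lead_coeff_mult by simp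
  then have "r \<noteq> 0" by (metis leading_coeff_0_iff zero_neq_one)
  then have "degree q = degree [:- z, 1:] + degree r" unfolding r by (intro degree_mult_eq) simp
  then have "card A = degree r" using deg by simp
  from insert.IH[OF lead this] obtain f where f: "r = (\<Prod>i\<in>A. [:- f i, 1:])" ..
  have "(\<Prod>i\<in>A. [:- (f(a := z)) i, 1:]) = (\<Prod>i\<in>A. [:- f i, 1:])"
    using insert.hyps by (intro prod.cong) auto
  then have "q = (\<Prod>i\<in>insert a A. [:- (f(a := z)) i, 1:])"
    unfolding r f prod.insert[OF insert.hyps(1,2)] by (simp only: fun_upd_same)
  then show ?case by blast
qed

text \<open>
  Recording the degree of the left factor makes it possible to compare factorizations at
  different parameters. The trivial types \<open>p = 0\<close> and \<open>p = degree Q\<close> are included.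
\<close>

definition monic_split :: "nat \<Rightarrow> complex poly poly \<Rightarrow> bool" where
  "monic_split p Q \<longleftrightarrow> (\<exists>F G. Q = F * G \<and> lead_coeff F = 1 \<and> lead_coeff G = 1 \<and> degree F = p)"

definition monic_poly_family :: "nat set \<Rightarrow> nat \<Rightarrow> ((nat \<Rightarrow> complex) \<Rightarrow> complex poly poly) \<Rightarrow> bool" where
  "monic_poly_family I n Q \<longleftrightarrow> (\<forall>c. lead_coeff (Q c) = 1 \<and> degree (Q c) = n) \<and>
     (\<exists>N. \<forall>c i. degree (coeff (Q c) i) \<le> N) \<and>
     (\<forall>i k. (\<lambda>c. coeff (coeff (Q c) i) k) \<in> poly_funs I)"

lemma monic_poly_familyD:
  assumes "monic_poly_family I n Q"
  shows "lead_coeff (Q c) = 1" "degree (Q c) = n" "(\<lambda>c. coeff (coeff (Q c) i) k) \<in> poly_funs I"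
    "\<exists>N. \<forall>c i. degree (coeff (Q c) i) \<le> N" "Q c \<noteq> 0"
proof -
  note * = assms[unfolded monic_poly_family_def]
  show "lead_coeff (Q c) = 1" "degree (Q c) = n"
    using conjunct1[OF *] by blast+
  then show "Q c \<noteq> 0" by (metis leading_coeff_0_iff zero_neq_one)
  show "\<exists>N. \<forall>c i. degree (coeff (Q c) i) \<le> N"
    by (rule conjunct1[OF conjunct2[OF *]])
  show "(\<lambda>c. coeff (coeff (Q c) i) k) \<in> poly_funs I"
    by (rule HOL.spec[OF HOL.spec[OF conjunct2[OF conjunct2[OF *]]]])
qed

lemma monic_poly_family_eval_inner:
  assumes Q: "monic_poly_family I n Q"
  shows "monic_coeff_family I n (\<lambda>c. eval_inner s (Q c))"
proof -
  obtain N where N: "\<forall>c i. degree (coeff (Q c) i) \<le> N" using monic_poly_familyD(4)[OF Q] ..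
  have "coeff (eval_inner s (Q c)) i = (\<Sum>k\<le>N. coeff (coeff (Q c) i) k * s ^ k)" for c i
    unfolding coeff_eval_inner poly_altdef using N
    by (intro sum.mono_neutral_left) (auto simp: coeff_eq_0)
  moreover have "(\<lambda>c. \<Sum>k\<le>N. coeff (coeff (Q c) i) k * s ^ k) \<in> poly_funs I" for i
    by (intro poly_funs_sum poly_funs.mult poly_funs.const monic_poly_familyD(3)[OF Q])
  ultimately show ?thesis
    unfolding monic_coeff_family_def
    using monic_eval_inner[OF monic_poly_familyD(1)[OF Q]] monic_poly_familyD(2)[OF Q] by simp
qed

lemma monic_coeff_family_value:
  assumes p: "monic_coeff_family I d p"
  shows "(\<lambda>x. poly (p x) l) \<in> poly_funs I"
proof -
  have "poly (p x) l = (\<Sum>k\<le>d. coeff (p x) k * l ^ k)" for x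
    using monic_coeff_familyD(2)[OF p, of x] by (simp add: poly_altdef)
  moreover have "(\<lambda>x. \<Sum>k\<le>d. coeff (p x) k * l ^ k) \<in> poly_funs I"
    by (intro poly_funs_sum poly_funs.mult poly_funs.const monic_coeff_familyD(4)[OF p])
  ultimately show ?thesis by simp
qed

text \<open>
  The type of a factorization specialises. The coefficients of the factors are not
  convenient unknowns, since it is not evident which monic equations they satisfy. The unknowns
  are instead the roots of \<open>F(j, \<lambda>)\<close> and \<open>G(j, \<lambda>)\<close> at the nodes \<open>t = 0, ..., N\<close>: each of them is
  a root of the monic polynomial \<open>Q(j, \<lambda>)\<close>, and the factors are recovered from them by Lagrange
  interpolation. The equation \<open>F G = Q\<close> is imposed at all points \<open>(s, l)\<close>, which gives an
  infinite system of polynomial equations.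
\<close>

theorem monic_split_closed:
  assumes Q: "monic_poly_family I n Q" and I: "I \<subseteq> {..<n}" and n: "0 < n" and p: "p \<le> n"
    and D: "zariski_dense I D" and split: "\<And>c. c \<in> D \<Longrightarrow> monic_split p (Q c)"
  shows "monic_split p (Q c)"
proof -
  obtain N where N: "\<And>c i. degree (coeff (Q c) i) \<le> N" using monic_poly_familyD(4)[OF Q] by blast
  \<comment> \<open>The unknown with index \<open>n + j n + i\<close> is the \<open>i\<close>-th root at the node \<open>t = j\<close>; the first \<open>p\<close> roots at
    each node belong to the left factor. The indices below \<open>n\<close> are those of the parameters.\<close>
  define X where "X = {n..<n + Suc N * n}"
  define r where "r k c = eval_inner (of_nat ((k - n) div n)) (Q c)" for k c
  define u where "u A y j = (\<Prod>i\<in>A. [:- y (n + j * n + i), 1:])" for A and y :: "nat \<Rightarrow> complex" and j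
  define h where "h s l y = poly (eval_inner s (interpolate N (u {..<p} y))) l *
      poly (eval_inner s (interpolate N (u {p..<n} y))) l - poly (eval_inner s (Q y)) l" for s l y
  define H where "H = {h s l | s l. True}"
  have X_disj: "X \<inter> I = {}" using I by (auto simp: X_def)
  have inX: "n + j * n + i \<in> X" if "j \<le> N" "i < n" for i j
  proof -
    have "j * n + i < Suc j * n" using that by simp
    also have "\<dots> \<le> Suc N * n" using that by (intro mult_le_mono1) simp
    finally show ?thesis by (simp add: X_def)
  qed
  have r: "monic_coeff_family I n (r k)" for k
    unfolding r_def by (rule monic_poly_family_eval_inner[OF Q])
  have u_monic: "lead_coeff (u A y j) = 1" "degree (u A y j) = card A" for A y j
    unfolding u_def by (subst lead_coeff_prod, simp) (simp add: degree_prod_eq_sum_degree)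
  have interp: "(\<lambda>y. poly (eval_inner s (interpolate N (u A y))) l) \<in> poly_funs (I \<union> X)"
    if "A \<subseteq> {..<n}" for A s l
  proof -
    have "poly (eval_inner s (interpolate N (u A y))) l =
        (\<Sum>j\<le>N. poly (lagrange_basis N j) s * (\<Prod>i\<in>A. l - y (n + j * n + i)))" for y
      by (simp add: poly_eval_inner_interpolate u_def poly_prod)
    moreover have "(\<lambda>y. \<Sum>j\<le>N. poly (lagrange_basis N j) s * (\<Prod>i\<in>A. l - y (n + j * n + i)))
        \<in> poly_funs (I \<union> X)"
      using that by (intro poly_funs_sum poly_funs.mult poly_funs.const poly_funs_prod
          poly_funs_diff poly_funs.coord) (auto intro!: inX)
    ultimately show ?thesis by simp
  qed
  have "(\<lambda>y. poly (eval_inner s (Q y)) l) \<in> poly_funs (I \<union> X)" for s l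
    by (rule poly_funs_mono[OF monic_coeff_family_value[OF monic_poly_family_eval_inner[OF Q]]]) simp
  then have H: "H \<subseteq> poly_funs (I \<union> X)"
    unfolding H_def h_def using p by (auto intro!: poly_funs_diff poly_funs.mult interp)
  have Q_cong: "Q y = Q c" if "y \<in> root_choices r X c" for y c
  proof (rule poly_eqI, rule poly_eqI)
    fix i k
    show "coeff (coeff (Q y) i) k = coeff (coeff (Q c) i) k"
      using that X_disj
      by (intro poly_funs_cong[OF monic_poly_familyD(3)[OF Q]]) (auto simp: root_choices_def)
  qed
  have sol: "\<exists>y\<in>root_choices r X c. \<forall>h\<in>H. h y = 0" if cD: "c \<in> D" for c
  proof -
    obtain F G where FG: "Q c = F * G" "lead_coeff F = 1" "lead_coeff G = 1" "degree F = p"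
      using split[OF cD] unfolding monic_split_def by blast
    have nz: "F \<noteq> 0" "G \<noteq> 0" using FG(2,3) by auto
    then have degG: "degree G = n - p"
      using monic_poly_familyD(2)[OF Q, of c] FG(1,4) by (simp add: degree_mult_eq)
    have "\<exists>f. eval_inner (of_nat j) F = (\<Prod>i<p. [:- f i, 1:])" for j
      using monic_eval_inner[OF FG(2)] FG(4) by (intro monic_complex_poly_splits) auto
    then obtain f where f: "\<And>j. eval_inner (of_nat j) F = (\<Prod>i<p. [:- f j i, 1:])" by metis
    have "\<exists>g. eval_inner (of_nat j) G = (\<Prod>i\<in>{p..<n}. [:- g i, 1:])" for j
      using monic_eval_inner[OF FG(3)] degG by (intro monic_complex_poly_splits) auto
    then obtain g where g: "\<And>j. eval_inner (of_nat j) G = (\<Prod>i\<in>{p..<n}. [:- g j i, 1:])" by metis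
    define y where "y k = (if k \<in> X then
        (if (k - n) mod n < p then f ((k - n) div n) ((k - n) mod n)
         else g ((k - n) div n) ((k - n) mod n)) else c k)" for k
    have y: "y (n + j * n + i) = (if i < p then f j i else g j i)" if "j \<le> N" "i < n" for i j
    proof -
      have "(n + j * n + i - n) mod n = i" "(n + j * n + i - n) div n = j" using that n by auto
      then show ?thesis using inX[OF that] by (simp add: y_def)
    qed
    have "poly (r k c) (y k) = 0" if "k \<in> X" for k
    proof -
      define i j where "i = (k - n) mod n" and "j = (k - n) div n"
      have "k - n < Suc N * n" using that by (auto simp: X_def)
      then have ij: "i < n" "j < Suc N" using n by (auto simp: i_def j_def less_mult_imp_div_less)
      have rk: "r k c = eval_inner (of_nat j) F * eval_inner (of_nat j) G"
        by (simp add: r_def j_def FG(1) eval_inner_mult)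
      show ?thesis
      proof (cases "i < p")
        case True
        then have "y k = f j i" using that by (simp add: y_def i_def j_def)
        then have "poly (eval_inner (of_nat j) F) (y k) = 0"
          using True by (auto simp: f poly_prod intro!: prod_zero bexI[of _ i])
        then show ?thesis by (simp add: rk)
      next
        case False
        then have "y k = g j i" using that by (simp add: y_def i_def j_def)
        then have "poly (eval_inner (of_nat j) G) (y k) = 0"
          using False ij by (auto simp: g poly_prod intro!: prod_zero bexI[of _ i])
        then show ?thesis by (simp add: rk)
      qed
    qed
    then have yc: "y \<in> root_choices r X c" by (auto simp: root_choices_def y_def)
    have uF: "u {..<p} y j = eval_inner (of_nat j) F" if "j \<le> N" for j
      unfolding u_def f using y[OF that] p by (intro prod.cong) auto
    have uG: "u {p..<n} y j = eval_inner (of_nat j) G" if "j \<le> N" for j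
      unfolding u_def g using y[OF that] by (intro prod.cong) auto
    have "interpolate N (u {..<p} y) = F"
    proof -
      have "interpolate N (u {..<p} y) = interpolate N (\<lambda>j. eval_inner (of_nat j) F)"
        unfolding interpolate_def using uF by (intro sum.cong) auto
      also have "\<dots> = F"
        using degree_factor_coeff_le[of F G] nz N[of c] FG(1) by (intro interpolate_eval_inner) simp
      finally show ?thesis .
    qed
    moreover have "interpolate N (u {p..<n} y) = G"
    proof -
      have "interpolate N (u {p..<n} y) = interpolate N (\<lambda>j. eval_inner (of_nat j) G)"
        unfolding interpolate_def using uG by (intro sum.cong) auto
      also have "\<dots> = G"
        using degree_factor_coeff_le[of G F] nz N[of c] FG(1)
        by (intro interpolate_eval_inner) (simp add: mult.commute)
      finally show ?thesis .
    qed
    ultimately have "\<forall>h\<in>H. h y = 0"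
      unfolding H_def h_def using Q_cong[OF yc] FG(1) by (auto simp: eval_inner_mult)
    then show ?thesis using yc by blast
  qed
  have "\<exists>y\<in>root_choices r X c. \<forall>h\<in>H. h y = 0"
    by (rule integral_system_solvable_everywhere[OF _ X_disj r H D sol]) (simp add: X_def)
  then obtain y where y: "y \<in> root_choices r X c" "\<forall>h\<in>H. h y = 0" ..
  define F G where "F = interpolate N (u {..<p} y)" and "G = interpolate N (u {p..<n} y)"
  have "poly (eval_inner s (Q c)) l = poly (eval_inner s (F * G)) l" for s l
  proof -
    have "h s l y = 0" using y(2) by (auto simp: H_def)
    then show ?thesis by (simp add: h_def F_def G_def eval_inner_mult Q_cong[OF y(1)])
  qed
  then have "Q c = F * G" by (rule poly_poly_eqI)
  moreover have "lead_coeff (interpolate N (u A y)) = 1" "degree (interpolate N (u A y)) = card A" for A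
    by (rule monic_interpolate[where p = "card A"]; rule u_monic)+
  then have "lead_coeff F = 1" "lead_coeff G = 1" "degree F = p"
    unfolding F_def G_def by (blast, blast, metis card_lessThan)
  ultimately show ?thesis unfolding monic_split_def by blast
qed

section \<open>Splitting and irreducibility\<close>

lemma monic_nonzero:
  fixes P :: "'a :: comm_semiring_1 poly"
  assumes "lead_coeff P = 1"
  shows "P \<noteq> 0"
  using assms by (metis leading_coeff_0_iff zero_neq_one)

lemma monic_split_of_dvd:
  assumes F: "lead_coeff F = 1" and Q: "lead_coeff Q = 1" and dvd: "F dvd Q"
  shows "monic_split (degree F) Q"
proof -
  obtain G where G: "Q = F * G" using dvd by (rule dvdE)
  have "lead_coeff G = 1" using F Q unfolding G lead_coeff_mult by simp
  then show ?thesis using F G unfolding monic_split_def by metis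
qed

lemma monic_split_complement:
  assumes "monic_split p Q"
  shows "monic_split (degree Q - p) Q"
proof -
  obtain F G where FG: "Q = F * G" "lead_coeff F = 1" "lead_coeff G = 1" "degree F = p"
    using assms unfolding monic_split_def by metis
  have "degree Q = degree F + degree G"
    unfolding FG(1) by (intro degree_mult_eq monic_nonzero FG)
  then have "degree G = degree Q - p" using FG(4) by simp
  moreover have "Q = G * F" by (simp add: FG(1) mult.commute)
  ultimately show ?thesis using FG unfolding monic_split_def by metis
qed

lemma irreducible_iff_no_monic_split:
  assumes Q: "lead_coeff Q = 1" "0 < degree Q"
  shows "irreducible Q \<longleftrightarrow> \<not> (\<exists>p. 0 < p \<and> p < degree Q \<and> monic_split p Q)"
proof
  assume irr: "irreducible Q"
  show "\<not> (\<exists>p. 0 < p \<and> p < degree Q \<and> monic_split p Q)"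
  proof
    assume "\<exists>p. 0 < p \<and> p < degree Q \<and> monic_split p Q"
    then obtain F G where FG: "Q = F * G" "lead_coeff F = 1" "lead_coeff G = 1"
      "0 < degree F" "degree F < degree Q"
      unfolding monic_split_def by metis
    have "degree Q = degree F + degree G"
      unfolding FG(1) by (intro degree_mult_eq monic_nonzero FG)
    then have "0 < degree G" using FG by simp
    have "F dvd 1 \<or> G dvd 1" using irreducibleD[OF irr FG(1)] .
    then show False using FG(4) \<open>0 < degree G\<close> by (auto simp: is_unit_poly_iff)
  qed
next
  assume no: "\<not> (\<exists>p. 0 < p \<and> p < degree Q \<and> monic_split p Q)"
  show "irreducible Q"
  proof (rule irreducibleI)
    show "Q \<noteq> 0" using Q(1) by (rule monic_nonzero)
    show "\<not> Q dvd 1" using Q(2) by (auto simp: is_unit_poly_iff)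
    fix a b assume ab: "Q = a * b"
    define F G where "F = Polynomial.smult (lead_coeff b) a" and "G = Polynomial.smult (lead_coeff a) b"
    have lead: "lead_coeff a * lead_coeff b = 1" using Q(1) unfolding ab lead_coeff_mult .
    then have nz: "lead_coeff a \<noteq> 0" "lead_coeff b \<noteq> 0" by auto
    have "F * G = Polynomial.smult (lead_coeff a * lead_coeff b) (a * b)"
      unfolding F_def G_def by (simp add: mult.commute)
    then have "Q = F * G" by (simp add: ab lead)
    moreover have "lead_coeff F = 1" "lead_coeff G = 1" "degree F = degree a"
      unfolding F_def G_def using nz lead by (simp_all add: mult.commute)
    ultimately have "monic_split (degree a) Q" unfolding monic_split_def by metis
    then have "degree a = 0 \<or> degree Q \<le> degree a" using no by (metis gr0I not_le)
    moreover have "degree Q = degree a + degree b"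
      unfolding ab using nz by (intro degree_mult_eq) auto
    ultimately consider "degree a = 0" | "degree b = 0" by linarith
    then show "a dvd 1 \<or> b dvd 1"
    proof cases
      case 1
      then obtain x where a: "a = [:x:]" by (rule degree_eq_zeroE)
      then have "x dvd 1" using lead by (metis coeff_pCons_0 degree_pCons_0 dvd_triv_left)
      then show ?thesis using a by (simp add: is_unit_poly_iff)
    next
      case 2
      then obtain x where b: "b = [:x:]" by (rule degree_eq_zeroE)
      then have "x dvd 1" using lead by (metis coeff_pCons_0 degree_pCons_0 dvd_triv_right)
      then show ?thesis using b by (simp add: is_unit_poly_iff)
    qed
  qed
qed

text \<open>
  Only finitely many types of factorization exist, so one of them occurs on a dense set, and
  then, by closedness, for every parameter.
\<close>

lemma dense_reducible_uniform_split:
  assumes Q: "monic_poly_family I n Q" and I: "I \<subseteq> {..<n}" and n: "0 < n"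
    and D: "zariski_dense I D" and red: "\<And>c. c \<in> D \<Longrightarrow> \<not> irreducible (Q c)"
  shows "\<exists>p. 0 < p \<and> p < n \<and> (\<forall>c. monic_split p (Q c))"
proof -
  have "D \<subseteq> (\<Union>p\<in>{0<..<n}. {c. monic_split p (Q c)})"
  proof
    fix c assume "c \<in> D"
    from red[OF this] obtain p where "0 < p" "p < n" "monic_split p (Q c)"
      using irreducible_iff_no_monic_split[OF monic_poly_familyD(1)[OF Q], of c]
        monic_poly_familyD(2)[OF Q, of c] n by auto
    then show "c \<in> (\<Union>p\<in>{0<..<n}. {c. monic_split p (Q c)})" by auto
  qed
  from zariski_dense_finite_Union[OF D _ this]
  obtain p where p: "p \<in> {0<..<n}" "zariski_dense I {c. monic_split p (Q c)}" by auto
  have "monic_split p (Q c)" for c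
    by (rule monic_split_closed[OF Q I n _ p(2)]) (use p(1) in auto)
  then show ?thesis using p(1) by auto
qed

section \<open>Statements for generic parameters\<close>

text \<open>
  The torus is dense in affine space: it is the complement of the zero set of the product of
  the coordinates.
\<close>

lemma torus_not_zero:
  assumes f: "f \<in> poly_funs {1..n - 1}" and x: "f x \<noteq> 0"
  shows "\<exists>c\<in>torus n. f c \<noteq> 0"
proof -
  define g where "g c = (\<Prod>i\<in>{1..n - 1}. c i)" for c :: "nat \<Rightarrow> complex"
  have "g \<in> poly_funs {1..n - 1}"
    unfolding g_def by (intro poly_funs_prod poly_funs.coord)
  moreover have "g (\<lambda>_. 1) \<noteq> 0" by (simp add: g_def)
  ultimately have "\<exists>z. f z \<noteq> 0 \<and> g z \<noteq> 0"
    by (rule poly_funs_common_nonzero[OF f _ x])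
  then obtain z where z: "f z \<noteq> 0" "g z \<noteq> 0" by (elim exE conjE)
  have "restrict z {1..n - 1} \<in> torus n"
    using z(2) by (auto simp: torus_def g_def)
  moreover have "f (restrict z {1..n - 1}) = f z"
    by (rule poly_funs_cong[OF f]) simp
  ultimately show ?thesis using z(1) by (intro bexI[of _ "restrict z {1..n - 1}"]) simp
qed

lemma not_generic_imp_zariski_dense:
  assumes "\<not> for_generic_c n P"
  shows "zariski_dense {1..n - 1} {c \<in> torus n. \<not> P c}"
  unfolding zariski_dense_def
proof (intro ballI impI allI)
  fix f x
  assume f: "f \<in> poly_funs {1..n - 1}" and van: "\<forall>c\<in>{c \<in> torus n. \<not> P c}. f c = 0"
  show "f x = 0"
  proof (rule ccontr)
    assume "f x \<noteq> 0"
    from torus_not_zero[OF f this] obtain c where c: "c \<in> torus n" "f c \<noteq> 0" ..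
    define Z where "Z = {c \<in> torus n. \<forall>h\<in>{f}. h c = 0}"
    have "zariski_closed_in_torus n Z"
      unfolding zariski_closed_in_torus_def Z_def using f by (intro exI[of _ "{f}"]) simp
    moreover have "Z \<noteq> torus n" using c by (auto simp: Z_def)
    moreover have "\<forall>c\<in>torus n - Z. P c" using van by (auto simp: Z_def)
    ultimately have "for_generic_c n P" unfolding for_generic_c_def by (intro exI[of _ Z] conjI)
    with assms show False ..
  qed
qed

lemma generic_of_all:
  assumes "\<And>c. P c"
  shows "for_generic_c n P"
proof -
  have "(\<lambda>_. 1) \<in> poly_funs {1..n - 1}" by (rule poly_funs.const)
  then have "zariski_closed_in_torus n {}"
    unfolding zariski_closed_in_torus_def by (intro exI[of _ "{\<lambda>_. 1}"]) simp
  moreover have "restrict (\<lambda>_. 1) {1..n - 1} \<in> torus n" by (auto simp: torus_def)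
  then have "{} \<noteq> torus n" by auto
  ultimately show ?thesis using assms unfolding for_generic_c_def by (intro exI[of _ "{}"]) simp
qed

lemma generic_witness:
  assumes "for_generic_c n P"
  shows "\<exists>f\<in>poly_funs {1..n - 1}. (\<exists>x. f x \<noteq> 0) \<and> (\<forall>c\<in>torus n. f c \<noteq> 0 \<longrightarrow> P c)"
proof -
  obtain Z where Z: "zariski_closed_in_torus n Z" "Z \<noteq> torus n" "\<forall>c\<in>torus n - Z. P c"
    using assms unfolding for_generic_c_def by (elim exE conjE)
  from Z(1) obtain F where F: "F \<subseteq> poly_funs {1..n - 1}" "Z = {c \<in> torus n. \<forall>f\<in>F. f c = 0}"
    unfolding zariski_closed_in_torus_def by (elim exE conjE)
  obtain c where "c \<in> torus n" "c \<notin> Z" using F(2) Z(2) by auto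
  then obtain f where f: "f \<in> F" "f c \<noteq> 0" using F(2) by auto
  then have "\<forall>c\<in>torus n. f c \<noteq> 0 \<longrightarrow> P c" using Z(3) F(2) by auto
  then show ?thesis using f F(1) by (intro bexI[of _ f]) auto
qed

text \<open>
  Two nonempty open subsets of the torus intersect.
\<close>

lemma generic_not_contradictory:
  assumes "for_generic_c n P" "for_generic_c n (\<lambda>c. \<not> P c)"
  shows False
proof -
  from generic_witness[OF assms(1)]
  obtain f x where f: "f \<in> poly_funs {1..n - 1}" "f x \<noteq> 0" "\<forall>c\<in>torus n. f c \<noteq> 0 \<longrightarrow> P c"
    by (elim bexE conjE exE)
  from generic_witness[OF assms(2)]
  obtain g y where g: "g \<in> poly_funs {1..n - 1}" "g y \<noteq> 0" "\<forall>c\<in>torus n. g c \<noteq> 0 \<longrightarrow> \<not> P c"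
    by (elim bexE conjE exE)
  from poly_funs_common_nonzero[OF f(1) g(1) f(2) g(2)]
  obtain z where z: "f z \<noteq> 0 \<and> g z \<noteq> 0" ..
  have "(\<lambda>c. f c * g c) \<in> poly_funs {1..n - 1}" by (rule poly_funs.mult[OF f(1) g(1)])
  from torus_not_zero[OF this, of z] z obtain c where "c \<in> torus n" "f c \<noteq> 0" "g c \<noteq> 0" by auto
  then show False using f(3) g(3) by auto
qed

text \<open>
  Irreducibility is an open condition, so one irreducible member of the family is enough. It
  may lie outside the torus, where some \<open>c\<^sub>i\<close> vanishes.
\<close>

lemma generic_irreducible_of_point:
  assumes Q: "monic_poly_family {1..n - 1} n Q" and n: "0 < n" and irr: "irreducible (Q c)"
  shows "for_generic_c n (\<lambda>c. irreducible (Q c))"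
proof (rule ccontr)
  assume "\<not> for_generic_c n (\<lambda>c. irreducible (Q c))"
  then have D: "zariski_dense {1..n - 1} {c \<in> torus n. \<not> irreducible (Q c)}"
    by (rule not_generic_imp_zariski_dense)
  have I: "{1..n - 1} \<subseteq> {..<n}" using n by auto
  have "\<exists>p. 0 < p \<and> p < n \<and> (\<forall>c. monic_split p (Q c))"
    by (rule dense_reducible_uniform_split[OF Q I n D]) simp
  then show False
    using irr irreducible_iff_no_monic_split[OF monic_poly_familyD(1)[OF Q], of c]
      monic_poly_familyD(2)[OF Q, of c] n by auto
qed

section \<open>Coefficients of continuants and cuts of the path\<close>

lemma coeff_linear_mult:
  fixes C :: "'a :: comm_ring_1 poly"
  shows "coeff ([:x, 1:] * C) i = x * coeff C i + (if i = 0 then 0 else coeff C (i - 1))"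
  by (cases i) simp_all

lemma continuant_monic: "degree (continuant a c n) = n \<and> lead_coeff (continuant a c n) = 1"
proof (induction a c n rule: continuant.induct)
  case (3 a c k)
  define A where "A = [:[:a (Suc (Suc k)):], 1:] * continuant a c (Suc k)"
  define B where "B = Polynomial.smult [:0, c (Suc k):] (continuant a c k)"
  have nz: "continuant a c (Suc k) \<noteq> 0" using 3 monic_nonzero by metis
  have "degree A = degree [:[:a (Suc (Suc k)):], 1:] + degree (continuant a c (Suc k))"
    unfolding A_def using nz by (intro degree_mult_eq) auto
  then have dA: "degree A = Suc (Suc k)" using 3 by simp
  have lA: "lead_coeff A = 1"
    unfolding A_def lead_coeff_mult conjunct2[OF 3(1)] by simp
  have "degree B \<le> degree (continuant a c k)" unfolding B_def by (rule degree_smult_le)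
  then have dB: "degree B < degree A" using 3 dA by simp
  have eq: "continuant a c (Suc (Suc k)) = A - B" by (simp add: A_def B_def)
  have "coeff (A - B) (Suc (Suc k)) = 1" using lA dB dA by (simp add: coeff_eq_0)
  moreover have "degree (A - B) \<le> Suc (Suc k)" using dA dB by (intro degree_diff_le) auto
  ultimately have "degree (A - B) = Suc (Suc k)" by (metis le_antisym le_degree zero_neq_one)
  with \<open>coeff (A - B) (Suc (Suc k)) = 1\<close> show ?case unfolding eq by simp
qed auto

text \<open>
  The recursion for single coefficients, from which the degree bound and the polynomial
  dependence on \<open>c\<close> follow.
\<close>

lemma coeff_coeff_continuant:
  "coeff (coeff (continuant a c (Suc (Suc m))) i) k =
     a (Suc (Suc m)) * coeff (coeff (continuant a c (Suc m)) i) k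
     + (if i = 0 then 0 else coeff (coeff (continuant a c (Suc m)) (i - 1)) k)
     - (if k = 0 then 0 else c (Suc m) * coeff (coeff (continuant a c m) i) (k - 1))"
  unfolding continuant.simps coeff_diff coeff_linear_mult coeff_smult
  by (cases k) auto

lemma continuant_degree_inner: "degree (coeff (continuant a c n) i) \<le> n"
proof (induction n arbitrary: i rule: induct_nat_012)
  case 1
  show ?case by (cases i) (auto simp: coeff_pCons split: nat.splits)
next
  case (ge2 m)
  have "coeff (coeff (continuant a c (Suc (Suc m))) i) k = 0" if "Suc (Suc m) < k" for k
  proof -
    have "coeff (coeff (continuant a c (Suc m)) j) k = 0" for j
      using ge2(2)[of j] that by (intro coeff_eq_0) linarith
    moreover have "coeff (coeff (continuant a c m) i) (k - 1) = 0"
      using ge2(1)[of i] that by (intro coeff_eq_0) linarith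
    ultimately show ?thesis unfolding coeff_coeff_continuant by (simp only: mult_zero_right if_cancel add_0_left diff_self)
  qed
  then show ?case by (intro degree_le) blast
qed simp

lemma continuant_coeff_poly_funs:
  "(\<lambda>c. coeff (coeff (continuant a c n) i) k) \<in> poly_funs {1..n - 1}"
proof (induction n arbitrary: i k rule: induct_nat_012)
  case 0
  show ?case by (simp add: poly_funs.const)
next
  case 1
  show ?case by (simp add: poly_funs.const)
next
  case (ge2 m)
  have 1: "(\<lambda>c. coeff (coeff (continuant a c (Suc m)) j) k) \<in> poly_funs {1..Suc (Suc m) - 1}" for j
    by (rule poly_funs_mono[OF ge2(2)]) auto
  have 2: "(\<lambda>c. coeff (coeff (continuant a c m) i) (k - 1)) \<in> poly_funs {1..Suc (Suc m) - 1}"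
    by (rule poly_funs_mono[OF ge2(1)]) auto
  have 3: "(\<lambda>c. c (Suc m)) \<in> poly_funs {1..Suc (Suc m) - 1}"
    by (rule poly_funs.coord) simp
  have 4: "(\<lambda>c. if i = 0 then 0 else coeff (coeff (continuant a c (Suc m)) (i - 1)) k)
      \<in> poly_funs {1..Suc (Suc m) - 1}"
    using 1[of "i - 1"] by (cases "i = 0") (simp_all only: if_True if_False simp_thms poly_funs.const)
  have 5: "(\<lambda>c. if k = 0 then 0 else c (Suc m) * coeff (coeff (continuant a c m) i) (k - 1))
      \<in> poly_funs {1..Suc (Suc m) - 1}"
    using poly_funs.mult[OF 3 2] by (cases "k = 0") (simp_all only: if_True if_False simp_thms poly_funs.const)
  show ?case unfolding coeff_coeff_continuant
    by (rule poly_funs_diff[OF poly_funs.add[OF poly_funs.mult[OF poly_funs.const 1] 4] 5])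
qed

lemma continuant_family: "monic_poly_family {1..n - 1} n (\<lambda>c. continuant a c n)"
  unfolding monic_poly_family_def
  by (intro conjI allI exI[of _ n] continuant_degree_inner continuant_coeff_poly_funs
      conjunct1[OF continuant_monic] conjunct2[OF continuant_monic])

lemma continuant_cong:
  "(\<And>i. 1 \<le> i \<Longrightarrow> i \<le> n \<Longrightarrow> a i = a' i) \<Longrightarrow> (\<And>i. 1 \<le> i \<Longrightarrow> i < n \<Longrightarrow> c i = c' i) \<Longrightarrow>
     continuant a c n = continuant a' c' n"
proof (induction n rule: induct_nat_012)
  case (ge2 m)
  have "continuant a c m = continuant a' c' m" "continuant a c (Suc m) = continuant a' c' (Suc m)"
    using ge2 by simp_all
  then show ?case using ge2.prems by simp
qed simp_all

text \<open>
  Where \<open>c\<^sub>k = 0\<close> the tridiagonal matrix is block diagonal; in terms of the underlying path, the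
  edge between the nodes \<open>k\<close> and \<open>k + 1\<close> is cut.
\<close>

lemma continuant_split:
  assumes "k = 0 \<or> c k = 0"
  shows "continuant a c (k + m) = continuant a c k * continuant (\<lambda>i. a (k + i)) (\<lambda>i. c (k + i)) m"
proof (induction m rule: induct_nat_012)
  case 1
  show ?case
  proof (cases k)
    case (Suc k')
    then show ?thesis using assms by (cases k') (simp_all add: mult.commute)
  qed simp
next
  case (ge2 m)
  have "continuant a c (k + Suc (Suc m)) = [:[:a (k + Suc (Suc m)):], 1:] * continuant a c (k + Suc m)
      - Polynomial.smult [:0, c (k + Suc m):] (continuant a c (k + m))" by simp
  also have "\<dots> = continuant a c k * continuant (\<lambda>i. a (k + i)) (\<lambda>i. c (k + i)) (Suc (Suc m))"
    unfolding ge2 continuant.simps right_diff_distrib mult_smult_right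
    by (simp only: mult.left_commute)
  finally show ?case .
qed simp

text \<open>
  Cutting off the first or the last node of the path.
\<close>

lemma end_block_embedding:
  assumes n: "2 \<le> n" and a': "a' = a \<or> a' = (\<lambda>i. a (1 + i))"
  shows "\<exists>c L. degree L = 1 \<and> lead_coeff L = 1 \<and> continuant a c n = L * continuant a' c' (n - 1)"
  using a'
proof
  assume a': "a' = a"
  define c where "c = c'(n - 1 := 0)"
  have "continuant a c (n - 1 + 1) = continuant a c (n - 1) * [:[:a n:], 1:]"
    using n by (subst continuant_split) (simp_all add: c_def)
  also have "continuant a c (n - 1) = continuant a' c' (n - 1)"
    unfolding a' by (rule continuant_cong) (auto simp: c_def)
  finally have "continuant a c n = [:[:a n:], 1:] * continuant a' c' (n - 1)"
    using n by (simp only: mult.commute le_add_diff_inverse2)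
  then show ?thesis by (intro exI[of _ c] exI[of _ "[:[:a n:], 1:]"]) simp
next
  assume a': "a' = (\<lambda>i. a (1 + i))"
  define c where "c j = (if j = 1 then 0 else c' (j - 1))" for j
  have "continuant a c (1 + (n - 1)) = [:[:a 1:], 1:] * continuant a' (\<lambda>i. c (1 + i)) (n - 1)"
    unfolding a' by (subst continuant_split) (simp_all add: c_def)
  also have "continuant a' (\<lambda>i. c (1 + i)) (n - 1) = continuant a' c' (n - 1)"
    by (rule continuant_cong) (auto simp: c_def)
  finally have "continuant a c n = [:[:a 1:], 1:] * continuant a' c' (n - 1)" using n by simp
  then show ?thesis by (intro exI[of _ c] exI[of _ "[:[:a 1:], 1:]"]) simp
qed

lemma irreducible_complex_poly_poly_prime:
  fixes P :: "complex poly poly"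
  shows "irreducible P \<Longrightarrow> prime_elem P"
  by (rule irreducible_imp_prime_elem_gcd)

text \<open>
  An irreducible factor of codegree one lies entirely in one of the two factors of any
  factorization, which leaves at most a linear polynomial for the other one.
\<close>

lemma split_type_of_large_irreducible_factor:
  assumes P: "irreducible P" and L: "degree L = 1" and Q: "lead_coeff (L * P) = 1"
    and p: "0 < p" "p < degree (L * P)" "monic_split p (L * P)"
  shows "p = 1 \<or> p = degree (L * P) - 1"
proof -
  obtain F G where FG: "L * P = F * G" "lead_coeff F = 1" "lead_coeff G = 1" "degree F = p"
    using p(3) unfolding monic_split_def by metis
  have nz: "F \<noteq> 0" "G \<noteq> 0" using FG by (simp_all add: monic_nonzero)
  have LP: "L \<noteq> 0" "P \<noteq> 0" using monic_nonzero[OF Q] by auto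
  have d: "degree (L * P) = 1 + degree P" using LP L by (simp add: degree_mult_eq)
  have d': "degree (L * P) = p + degree G" unfolding FG(1) using nz FG(4) by (simp add: degree_mult_eq)
  have "P dvd F * G" unfolding FG(1)[symmetric] by simp
  then have "P dvd F \<or> P dvd G"
    using irreducible_complex_poly_poly_prime[OF P] by (simp add: prime_elem_dvd_mult_iff)
  then have "degree P \<le> p \<or> degree P \<le> degree G"
    using dvd_imp_degree_le[of P F] dvd_imp_degree_le[of P G] nz FG(4) by metis
  then show ?thesis using d d' p by linarith
qed

section \<open>Irreducible continuants\<close>

lemma degree_const_plus: "degree ([:x:] + g) = degree g"
proof (cases "degree g = 0")
  case True
  then obtain y where "g = [:y:]" by (rule degree_eq_zeroE)
  then show ?thesis by simp
qed (simp add: degree_add_eq_right)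

text \<open>
  The determinant of a block of two joined nodes has no zero \<open>\<lambda> = g(t)\<close>: the left-hand side
  has even degree in \<open>t\<close>.
\<close>

lemma edge_no_root:
  fixes g :: "complex poly"
  shows "([:x:] + g) * ([:y:] + g) \<noteq> [:0, 1:]"
proof
  assume eq: "([:x:] + g) * ([:y:] + g) = [:0, 1:]"
  then have "[:x:] + g \<noteq> 0" "[:y:] + g \<noteq> 0" by auto
  then have "degree (([:x:] + g) * ([:y:] + g)) = degree ([:x:] + g) + degree ([:y:] + g)"
    by (rule degree_mult_eq)
  then have "degree (([:x:] + g) * ([:y:] + g)) = degree g + degree g"
    unfolding degree_const_plus .
  then have "degree g + degree g = 1" unfolding eq by simp
  then show False by presburger
qed

lemma continuant_numeral:
  "continuant a c 2 = [:[:a 2:], 1:] * [:[:a 1:], 1:] - Polynomial.smult [:0, c 1:] 1"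
  "continuant a c 3 = [:[:a 3:], 1:] * continuant a c 2 - Polynomial.smult [:0, c 2:] [:[:a 1:], 1:]"
  by (simp_all add: numeral_2_eq_2 numeral_3_eq_3)

lemma poly_continuant_numeral:
  "poly (continuant a c 2) g = ([:a 2:] + g) * ([:a 1:] + g) - [:0, c 1:]"
  "poly (continuant a c 3) g = ([:a 3:] + g) * (([:a 2:] + g) * ([:a 1:] + g) - [:0, c 1:])
     - [:0, c 2:] * ([:a 1:] + g)"
proof -
  have lin: "poly [:[:x:], 1:] g = [:x:] + g" for x :: complex by simp
  show "poly (continuant a c 2) g = ([:a 2:] + g) * ([:a 1:] + g) - [:0, c 1:]"
    "poly (continuant a c 3) g = ([:a 3:] + g) * (([:a 2:] + g) * ([:a 1:] + g) - [:0, c 1:])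
     - [:0, c 2:] * ([:a 1:] + g)"
    by (simp_all only: continuant_numeral poly_diff poly_mult poly_smult poly_1 mult_1_right lin)
qed

text \<open>
  The edges \<open>{1,2}, {3,4}, ...\<close> cut the path into blocks of two nodes.
\<close>

lemma matching_no_root:
  assumes "\<And>j. 1 \<le> j \<Longrightarrow> j \<le> 2 * m \<Longrightarrow> c j = (if odd j then 1 else 0)"
  shows "poly (continuant a c (2 * m)) g \<noteq> 0"
  using assms
proof (induction m arbitrary: a c)
  case (Suc m)
  have c: "c 2 = 0" "c 1 = 1" using Suc.prems[of 2] Suc.prems[of 1] by simp_all
  have "continuant a c (2 * Suc m) = continuant a c (2 + 2 * m)" by simp
  also have "\<dots> = continuant a c 2 * continuant (\<lambda>i. a (2 + i)) (\<lambda>i. c (2 + i)) (2 * m)"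
    using c by (intro continuant_split) simp
  finally have eq: "continuant a c (2 * Suc m) =
      continuant a c 2 * continuant (\<lambda>i. a (2 + i)) (\<lambda>i. c (2 + i)) (2 * m)" .
  have "poly (continuant a c 2) g = ([:a 2:] + g) * ([:a 1:] + g) - [:0, 1:]"
    unfolding poly_continuant_numeral c ..
  then have "poly (continuant a c 2) g \<noteq> 0" using edge_no_root[of "a 2" g "a 1"] by simp
  moreover have "poly (continuant (\<lambda>i. a (2 + i)) (\<lambda>i. c (2 + i)) (2 * m)) g \<noteq> 0"
    using Suc.prems by (intro Suc.IH) simp
  ultimately show ?case unfolding eq poly_mult by (simp only: mult_eq_0_iff simp_thms)
qed simp

text \<open>
  Let \<open>A\<^sub>i = a\<^sub>i + g\<close>. A zero \<open>\<lambda> = g(t)\<close> means \<open>A\<^sub>1 A\<^sub>2 A\<^sub>3 = t (x A\<^sub>3 + A\<^sub>1)\<close>. For \<open>g\<close> of degree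
  \<open>d > 0\<close> the sides have degrees \<open>3 d\<close> and at most \<open>1 + d\<close>, so \<open>g\<close> is a constant \<open>z\<close>. A
  constant equals a multiple of \<open>t\<close> only if both vanish.
\<close>

lemma path3_root:
  assumes root: "poly (continuant a c 3) g = 0" and c: "c 1 = x" "c 2 = 1"
  shows "\<exists>z. (a 1 + z) * (a 2 + z) * (a 3 + z) = 0 \<and> x * (a 3 + z) + (a 1 + z) = 0"
proof -
  define A where "A i = [:a i:] + g" for i
  define T X :: "complex poly" where "T = [:0, 1:]" and "X = [:x:]"
  have "A 3 * (A 2 * A 1 - T * X) - T * A 1 = 0"
    using root unfolding poly_continuant_numeral c A_def T_def X_def by simp
  then have "A 1 * A 2 * A 3 = T * (X * A 3 + A 1)" by (simp add: algebra_simps)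
  then have eq: "A 1 * A 2 * A 3 = [:0, 1:] * ([:x:] * A 3 + A 1)" unfolding T_def X_def .
  have deg: "degree (A i) = degree g" for i unfolding A_def by (rule degree_const_plus)
  have d0: "degree g = 0"
  proof (rule ccontr)
    assume pos: "degree g \<noteq> 0"
    then have nz: "A i \<noteq> 0" for i using deg[of i] by auto
    then have "degree (A 1 * A 2 * A 3) = degree (A 1) + degree (A 2) + degree (A 3)"
      by (subst degree_mult_eq) (simp_all add: degree_mult_eq)
    then have "degree (A 1 * A 2 * A 3) = degree g + degree g + degree g" unfolding deg .
    moreover have "degree ([:x:] * A 3 + A 1) \<le> degree g"
    proof (rule degree_add_le)
      show "degree ([:x:] * A 3) \<le> degree g"
        using degree_mult_le[of "[:x:]" "A 3"] deg by simp
    qed (simp add: deg)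
    then have "degree ([:0, 1:] * ([:x:] * A 3 + A 1)) \<le> 1 + degree g"
      using degree_mult_le[of "[:0, 1:]" "[:x:] * A 3 + A 1"] by simp
    ultimately show False using eq pos by simp
  qed
  then obtain z where z: "g = [:z:]" by (rule degree_eq_zeroE)
  have "[:(a 1 + z) * (a 2 + z) * (a 3 + z):] = [:0, x * (a 3 + z) + (a 1 + z):]"
    using eq unfolding A_def z by (simp add: algebra_simps)
  then show ?thesis by (intro exI[of _ z]) (auto split: if_splits)
qed

text \<open>
  If \<open>a\<^sub>1\<close> and \<open>a\<^sub>3\<close> differ, the only constant zero left is \<open>- a\<^sub>2\<close>, and it can satisfy
  the linear condition for at most one nonzero value of \<open>x\<close>.
\<close>

lemma path3_root_pair:
  assumes "\<And>x. \<exists>g. poly (continuant a (c x) 3) g = 0" "\<And>x. c x 1 = x" "\<And>x. c x 2 = 1"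
  shows "a 3 = a 1"
proof (rule ccontr)
  assume ne: "a 3 \<noteq> a 1"
  have "\<exists>z. (a 1 + z) * (a 2 + z) * (a 3 + z) = 0 \<and> x * (a 3 + z) + (a 1 + z) = 0" for x
  proof -
    obtain g where "poly (continuant a (c x) 3) g = 0" using assms(1) ..
    then show ?thesis using assms(2,3) by (rule path3_root)
  qed
  moreover have "z = - a 2"
    if "x \<noteq> 0" "(a 1 + z) * (a 2 + z) * (a 3 + z) = 0" "x * (a 3 + z) + (a 1 + z) = 0" for x z
  proof -
    have "a 1 + z \<noteq> 0"
    proof
      assume z: "a 1 + z = 0"
      then have "a 3 + z = 0" using that(1,3) by simp
      with z show False using ne by (metis add_right_imp_eq)
    qed
    moreover have "a 3 + z \<noteq> 0"
    proof
      assume z: "a 3 + z = 0"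
      then have "a 1 + z = 0" using that(3) by simp
      with z show False using ne by (metis add_right_imp_eq)
    qed
    ultimately have "a 2 + z = 0" using that(2) by simp
    then show ?thesis by (metis add.inverse_unique add.commute)
  qed
  ultimately have *: "x * (a 3 - a 2) + (a 1 - a 2) = 0" if "x \<noteq> 0" for x
    using that by (metis add_uminus_conv_diff)
  have "a 3 - a 2 = (2 * (a 3 - a 2) + (a 1 - a 2)) - (1 * (a 3 - a 2) + (a 1 - a 2))"
    by (simp add: algebra_simps)
  also have "\<dots> = 0" using *[of 1] *[of 2] by simp
  finally have "a 3 - a 2 = 0" .
  with *[of 1] have "a 1 - a 2 = 0" by simp
  with \<open>a 3 - a 2 = 0\<close> ne show False by simp
qed

lemma monic_split_1_root:
  assumes "monic_split 1 Q"
  shows "\<exists>g. poly Q g = 0"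
proof -
  obtain F G where FG: "Q = F * G" "lead_coeff F = 1" "degree F = 1"
    using assms unfolding monic_split_def by metis
  then obtain f k where F: "F = [:f, k:]" using degree1_coeffs by metis
  then have "k = 1" using FG(2,3) by simp
  then have "poly F (- f) = 0" using F by simp
  then have "poly Q (- f) = 0" unfolding FG(1) poly_mult by (simp only: mult_zero_left)
  then show ?thesis ..
qed

text \<open>
  For \<open>n \<ge> 3\<close> these are the diagonals for which the continuant is always reducible: the entries at odd positions
  agree and, for even \<open>n\<close>, so do those at even positions. The step form passes easily to
  subpaths.
\<close>

definition alternating :: "nat \<Rightarrow> (nat \<Rightarrow> complex) \<Rightarrow> bool" where
  "alternating n a \<longleftrightarrow> (\<forall>i. 1 \<le> i \<and> i + 2 \<le> n \<and> (odd i \<or> even n) \<longrightarrow> a (i + 2) = a i)"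

text \<open>
  A path whose diagonal is not alternating keeps this property after the removal of a suitable
  end node: the steps \<open>i \<rightarrow> i + 2\<close> in the definition avoid one of the two ends and have the right parity
  on the shorter path. For \<open>n = 3\<close> this fails, since all diagonals of length two are alternating.
\<close>

lemma alternating_of_subpaths:
  assumes n: "4 \<le> n" and 1: "alternating (n - 1) a" and 2: "alternating (n - 1) (\<lambda>i. a (1 + i))"
  shows "alternating n a"
  unfolding alternating_def
proof (intro allI impI)
  fix i assume i: "1 \<le> i \<and> i + 2 \<le> n \<and> (odd i \<or> even n)"
  show "a (i + 2) = a i"
  proof (cases "i + 2 \<le> n - 1 \<and> (odd i \<or> odd n)")
    case True
    moreover have "even (n - 1) \<longleftrightarrow> odd n" using n by simp
    ultimately show ?thesis using 1 i unfolding alternating_def by blast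
  next
    case False
    have "2 \<le> i"
    proof (rule ccontr)
      assume "\<not> 2 \<le> i"
      then have "i = 1" using i by simp
      then show False using False n by simp
    qed
    moreover have "odd (i - 1) \<or> even (n - 1)"
    proof (rule ccontr)
      assume "\<not> (odd (i - 1) \<or> even (n - 1))"
      then have par: "odd i" "even n" using \<open>2 \<le> i\<close> n by simp_all
      then have "i + 2 \<noteq> n" by auto
      with i have "i + 2 \<le> n - 1" by linarith
      then show False using False par by simp
    qed
    moreover have "1 \<le> i - 1" "i - 1 + 2 \<le> n - 1" using \<open>2 \<le> i\<close> i by linarith+
    ultimately have "a (1 + (i - 1 + 2)) = a (1 + (i - 1))"
      using 2[unfolded alternating_def] by blast
    then show ?thesis using \<open>2 \<le> i\<close> by simp
  qed
qed

text \<open>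
  A factor that is linear in \<open>\<lambda>\<close> gives a zero \<open>\<lambda> = g(t)\<close>. For even \<open>n\<close> the perfect matching
  of the path excludes it. For odd \<open>n\<close> and odd \<open>i\<close> the path is cut into the block of the nodes
  \<open>i, i + 1, i + 2\<close> and blocks of two nodes. The zero then belongs to the block of three nodes,
  which forces \<open>a\<^sub>i = a\<^sub>i\<^sub>+\<^sub>2\<close>.
\<close>

lemma linear_split_imp_alternating:
  assumes n: "1 \<le> n" and split: "\<And>c. monic_split 1 (continuant a c n)"
  shows "alternating n a"
proof (cases "even n")
  case True
  then obtain m where m: "n = 2 * m" by (rule evenE)
  define c :: "nat \<Rightarrow> complex" where "c j = (if odd j then 1 else 0)" for j
  obtain g where "poly (continuant a c n) g = 0" using monic_split_1_root[OF split] ..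
  moreover have "poly (continuant a c (2 * m)) g \<noteq> 0"
    by (rule matching_no_root) (simp add: c_def)
  ultimately show ?thesis using m by simp
next
  case False
  show ?thesis unfolding alternating_def
  proof (intro allI impI)
    fix i assume i: "1 \<le> i \<and> i + 2 \<le> n \<and> (odd i \<or> even n)"
    then have "odd i" using False by simp
    then obtain q where q: "i = 2 * q + 1" by (rule oddE)
    have "even (n - (i + 2))" using False \<open>odd i\<close> i by simp
    then obtain m where "n - (i + 2) = 2 * m" by (rule evenE)
    then have nm: "n = 2 * q + (3 + 2 * m)" using q i by simp
    \<comment> \<open>The edges at \<open>i\<close> and \<open>i + 1\<close> have the weights \<open>x\<close> and \<open>1\<close>; on both sides of the block the
      remaining nodes are matched in pairs.\<close>
    define c :: "complex \<Rightarrow> nat \<Rightarrow> complex" where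
      "c x j = (if j < i then (if odd j then 1 else 0) else if j = i then x else if j = i + 1 then 1
         else if even j then 1 else 0)" for x j
    define a1 c1 where "a1 = (\<lambda>j. a (2 * q + j))" and "c1 = (\<lambda>x j. c x (2 * q + j))"
    have "\<exists>g. poly (continuant a1 (c1 x) 3) g = 0" for x
    proof -
      obtain g where g: "poly (continuant a (c x) n) g = 0"
        using monic_split_1_root[OF split] ..
      have "continuant a (c x) n = continuant a (c x) (2 * q) * continuant a1 (c1 x) (3 + 2 * m)"
        unfolding nm a1_def c1_def by (rule continuant_split) (simp add: c_def q)
      also have "continuant a1 (c1 x) (3 + 2 * m) =
          continuant a1 (c1 x) 3 * continuant (\<lambda>j. a1 (3 + j)) (\<lambda>j. c1 x (3 + j)) (2 * m)"
        by (rule continuant_split) (simp add: c1_def c_def q)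
      finally have eq: "continuant a (c x) n = continuant a (c x) (2 * q) *
          (continuant a1 (c1 x) 3 * continuant (\<lambda>j. a1 (3 + j)) (\<lambda>j. c1 x (3 + j)) (2 * m))" .
      have "poly (continuant a (c x) (2 * q)) g \<noteq> 0"
        by (rule matching_no_root) (simp add: c_def q)
      moreover have "poly (continuant (\<lambda>j. a1 (3 + j)) (\<lambda>j. c1 x (3 + j)) (2 * m)) g \<noteq> 0"
        by (rule matching_no_root) (simp add: c1_def c_def q)
      ultimately have "poly (continuant a1 (c1 x) 3) g = 0"
        using g unfolding eq poly_mult by (simp only: mult_eq_0_iff simp_thms)
      then show ?thesis ..
    qed
    then have "a1 3 = a1 1"
      by (rule path3_root_pair) (simp_all add: c1_def c_def q)
    moreover have "i + 2 = 2 * q + 3" "i = 2 * q + 1" using q by simp_all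
    ultimately show "a (i + 2) = a i" unfolding a1_def by (simp only:)
  qed
qed

text \<open>
  Suppose that the continuant were reducible for all \<open>c\<close>. One type of factorization then occurs for
  all \<open>c\<close>. Cutting off a suitable end node leaves, by induction, an irreducible continuant of
  degree \<open>n - 1\<close> for some \<open>c\<close>, so one of the factors is linear in \<open>\<lambda>\<close>. By uniformity there is a
  linear factor for all \<open>c\<close>, which only alternating diagonals allow.
\<close>

theorem exists_irreducible_continuant:
  assumes "3 \<le> n" "\<not> alternating n a"
  shows "\<exists>c. irreducible (continuant a c n)"
  using assms
proof (induction n arbitrary: a rule: less_induct)
  case (less n)
  show ?case
  proof (rule ccontr)
    assume "\<not> (\<exists>c. irreducible (continuant a c n))"
    then have "\<exists>p. 0 < p \<and> p < n \<and> (\<forall>c. monic_split p (continuant a c n))"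
      using less.prems(1)
      by (intro dense_reducible_uniform_split[OF continuant_family _ _ zariski_dense_UNIV]) auto
    then obtain p where p: "0 < p" "p < n" "\<And>c. monic_split p (continuant a c n)" by auto
    have "p = 1 \<or> p = n - 1"
    proof (cases "n = 3")
      case True
      then show ?thesis using p(1,2) by auto
    next
      case False
      then have n: "4 \<le> n" using less.prems(1) by simp
      then obtain a' where a': "a' = a \<or> a' = (\<lambda>i. a (1 + i))" "\<not> alternating (n - 1) a'"
        using alternating_of_subpaths[OF n, of a] less.prems(2) by metis
      have "\<exists>c'. irreducible (continuant a' c' (n - 1))"
        by (rule less.IH) (use n a'(2) in auto)
      then obtain c' where c': "irreducible (continuant a' c' (n - 1))" ..
      have "\<exists>c L. degree L = 1 \<and> lead_coeff L = 1 \<and> continuant a c n = L * continuant a' c' (n - 1)"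
        by (rule end_block_embedding[OF _ a'(1)]) (use n in simp)
      then obtain c L where L: "degree L = 1" "lead_coeff L = 1"
        "continuant a c n = L * continuant a' c' (n - 1)" by (elim exE conjE)
      have Q: "lead_coeff (continuant a c n) = 1" "degree (continuant a c n) = n"
        using continuant_monic by blast+
      show ?thesis
        using split_type_of_large_irreducible_factor[OF c' L(1), of p] p(1,2) p(3)[of c] Q
        unfolding L(3) by (simp only: simp_thms)
    qed
    moreover have "monic_split 1 (continuant a c n)" if "p = n - 1" for c
    proof -
      have "monic_split (degree (continuant a c n) - p) (continuant a c n)"
        by (rule monic_split_complement[OF p(3)])
      moreover have "degree (continuant a c n) - p = 1"
        using that less.prems(1) continuant_monic[of a c n] by simp
      ultimately show ?thesis by simp
    qed
    ultimately have "monic_split 1 (continuant a c n)" for c using p(3) by metis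
    then have "alternating n a"
      using less.prems(1) by (intro linear_split_imp_alternating) auto
    then show False using less.prems(2) by simp
  qed
qed

section \<open>The substitution of a square\<close>

definition subst_square :: "complex poly poly \<Rightarrow> complex poly poly" where
  "subst_square P = map_poly (\<lambda>q. pcompose q (monom 1 2)) P"

lemma coeff_pcompose_square:
  "coeff (pcompose q (monom 1 2)) k = (if even k then coeff q (k div 2) else 0)"
  for q :: "complex poly"
proof (induction q arbitrary: k)
  case (pCons a q)
  show ?case
  proof (cases "k < 2")
    case True
    then have "k = 0 \<or> k = 1" by auto
    then show ?thesis by (auto simp: pcompose_pCons coeff_monom_mult)
  next
    case False
    then obtain j where k: "k = Suc (Suc j)" by (metis add_2_eq_Suc le_Suc_ex not_less)
    then show ?thesis using pCons.IH[of j] by (simp add: pcompose_pCons coeff_monom_mult)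
  qed
qed simp

lemma coeff_subst_square: "coeff (subst_square P) i = pcompose (coeff P i) (monom 1 2)"
  by (simp add: subst_square_def coeff_map_poly)

lemma subst_square_mult: "subst_square (P * Q) = subst_square P * subst_square Q"
  by (rule poly_eqI) (simp add: coeff_subst_square coeff_mult pcompose_sum pcompose_mult)

lemma subst_square_inject: "subst_square P = subst_square Q \<longleftrightarrow> P = Q"
proof
  assume eq: "subst_square P = subst_square Q"
  have "coeff (coeff P i) k = coeff (coeff Q i) k" for i k
  proof -
    have "coeff (coeff (subst_square P) i) (2 * k) = coeff (coeff (subst_square Q) i) (2 * k)"
      by (simp only: eq)
    then show ?thesis by (simp add: coeff_subst_square coeff_pcompose_square)
  qed
  then have "coeff P i = coeff Q i" for i by (intro poly_eqI)
  then show "P = Q" by (rule poly_eqI)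
qed simp

lemma degree_subst_square: "degree (subst_square P) = degree P"
proof (cases "P = 0")
  case False
  have "pcompose q (monom 1 2) = 0 \<longleftrightarrow> q = 0" for q :: "complex poly"
    by (simp add: pcompose_eq_0_iff degree_monom_eq)
  then have "coeff (subst_square P) (degree P) \<noteq> 0"
    using False by (simp add: coeff_subst_square)
  then have "degree P \<le> degree (subst_square P)" by (rule le_degree)
  moreover have "degree (subst_square P) \<le> degree P"
    by (rule degree_le) (simp add: coeff_subst_square coeff_eq_0)
  ultimately show ?thesis by simp
qed (simp add: subst_square_def)

lemma monic_subst_square: "lead_coeff P = 1 \<Longrightarrow> lead_coeff (subst_square P) = 1"
  by (simp add: degree_subst_square coeff_subst_square pcompose_1)

lemma monic_split_subst_square: "monic_split p P \<Longrightarrow> monic_split p (subst_square P)"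
  unfolding monic_split_def using subst_square_mult monic_subst_square degree_subst_square by metis

lemma chi_eq: "chi a c n = subst_square (continuant a c n)"
  by (simp add: chi_def subst_square_def)

lemma chi_monic: "lead_coeff (chi a c n) = 1" "degree (chi a c n) = n"
  unfolding chi_eq using monic_subst_square degree_subst_square continuant_monic by metis+

lemma chi_family: "monic_poly_family {1..n - 1} n (\<lambda>c. chi a c n)"
  unfolding monic_poly_family_def
proof (intro conjI allI)
  fix i k
  show "(\<lambda>c. coeff (coeff (chi a c n) i) k) \<in> poly_funs {1..n - 1}"
    unfolding chi_eq coeff_subst_square coeff_pcompose_square
    by (cases "even k") (simp_all only: if_True if_False poly_funs.const continuant_coeff_poly_funs)
next
  have "degree (coeff (chi a c n) i) \<le> n * 2" for c i
    unfolding chi_eq coeff_subst_square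
    using continuant_degree_inner[of a c n i] by (simp add: degree_pcompose degree_monom_eq)
  then show "\<exists>N. \<forall>c i. degree (coeff (chi a c n) i) \<le> N" by blast
qed (rule chi_monic)+

definition reflect_inner :: "complex poly poly \<Rightarrow> complex poly poly" where
  "reflect_inner P = map_poly (\<lambda>q. pcompose q [:0, - 1:]) P"

lemma coeff_reflect_inner: "coeff (reflect_inner P) i = pcompose (coeff P i) [:0, - 1:]"
  by (simp add: reflect_inner_def coeff_map_poly)

lemma reflect_inner_mult: "reflect_inner (P * Q) = reflect_inner P * reflect_inner Q"
  by (rule poly_eqI) (simp add: coeff_reflect_inner coeff_mult pcompose_sum pcompose_mult)

lemma reflect_inner_reflect_inner: "reflect_inner (reflect_inner P) = P"
proof (rule poly_eqI)
  fix i
  have "pcompose [:0, - 1 :: complex:] [:0, - 1:] = [:0, 1:]" by (simp add: pcompose_pCons)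
  then show "coeff (reflect_inner (reflect_inner P)) i = coeff P i"
    by (simp only: coeff_reflect_inner pcompose_assoc[symmetric] pcompose_idR)
qed

lemma reflect_inner_subst_square: "reflect_inner (subst_square P) = subst_square P"
proof (rule poly_eqI)
  fix i
  have "pcompose (monom 1 2) [:0, - 1 :: complex:] = monom 1 2"
    by (simp add: monom_altdef pcompose_pCons power2_eq_square pcompose_mult)
  then show "coeff (reflect_inner (subst_square P)) i = coeff (subst_square P) i"
    by (simp only: coeff_reflect_inner coeff_subst_square pcompose_assoc[symmetric])
qed

lemma monic_reflect_inner:
  assumes "lead_coeff P = 1"
  shows "degree (reflect_inner P) = degree P" "lead_coeff (reflect_inner P) = 1"
proof -
  have 1: "coeff (reflect_inner P) (degree P) = 1"
    using assms by (simp add: coeff_reflect_inner pcompose_1)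
  moreover have "degree (reflect_inner P) \<le> degree P"
    by (rule degree_le) (simp add: coeff_reflect_inner coeff_eq_0)
  ultimately show "degree (reflect_inner P) = degree P"
    by (metis le_antisym le_degree zero_neq_one)
  then show "lead_coeff (reflect_inner P) = 1" using 1 by simp
qed

text \<open>
  The polynomials in \<open>w\<^sup>2\<close> and \<open>\<lambda>\<close> are those invariant under \<open>w \<mapsto> - w\<close>.
\<close>

lemma even_descent:
  assumes even: "reflect_inner A = A"
  shows "\<exists>B. subst_square B = A"
proof -
  define halve where "halve q = Abs_poly (\<lambda>k. coeff q (2 * k))" for q :: "complex poly"
  have coeff_halve: "coeff (halve q) k = coeff q (2 * k)" for q k
  proof -
    have "coeff q (2 * j) = 0" if "degree q < j" for j using that by (simp add: coeff_eq_0)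
    then show ?thesis unfolding halve_def by (subst coeff_Abs_poly[of "degree q"]) simp_all
  qed
  have halve0: "halve 0 = 0" by (rule poly_eqI) (simp add: coeff_halve)
  have "subst_square (map_poly halve A) = A"
  proof (rule poly_eqI)
    fix i
    have odd0: "coeff (coeff A i) k = 0" if "odd k" for k
    proof -
      have "coeff (coeff A i) k = (- 1) ^ k * coeff (coeff A i) k"
        using arg_cong[OF even, of "\<lambda>P. coeff (coeff P i) k"]
        by (simp only: coeff_reflect_inner coeff_pcompose_linear)
      then show ?thesis using that by simp
    qed
    show "coeff (subst_square (map_poly halve A)) i = coeff A i"
    proof (rule poly_eqI)
      fix k
      have "coeff (coeff (subst_square (map_poly halve A)) i) k =
          (if even k then coeff (coeff A i) (2 * (k div 2)) else 0)"
        unfolding coeff_subst_square coeff_pcompose_square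
        by (simp add: coeff_map_poly[of halve, OF halve0] coeff_halve)
      also have "\<dots> = coeff (coeff A i) k" using odd0[of k] by simp
      finally show "coeff (coeff (subst_square (map_poly halve A)) i) k = coeff (coeff A i) k" .
    qed
  qed
  then show ?thesis ..
qed

lemma square_of_prime_factor_degree:
  fixes P A B :: "complex poly poly"
  assumes P: "irreducible P" and AB: "A * B = P * P" and pos: "0 < degree A" "0 < degree B"
  shows "degree A = degree P"
proof -
  have P0: "P \<noteq> 0" using P by auto
  then have nz: "A \<noteq> 0" "B \<noteq> 0" using AB by auto
  have deg: "degree A + degree B = degree P + degree P"
    using arg_cong[OF AB, of degree] nz P0 by (simp add: degree_mult_eq)
  have quotient: "degree X = degree P"
    if X: "X * Y = P * P" "0 < degree Y" "P dvd X" for X Y :: "complex poly poly"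
  proof -
    obtain C where C: "X = P * C" using X(3) by (rule dvdE)
    then have "P = C * Y" using X(1) P0 by (simp add: mult.assoc)
    then have "C dvd 1 \<or> Y dvd 1" by (rule irreducibleD[OF P])
    then have "C dvd 1" using X(2) by (auto simp: is_unit_poly_iff)
    then have "degree C = 0" "C \<noteq> 0" by (auto simp: is_unit_poly_iff)
    then show ?thesis unfolding C using P0 by (simp add: degree_mult_eq)
  qed
  have "P dvd A * B" unfolding AB by simp
  then have "P dvd A \<or> P dvd B"
    using irreducible_complex_poly_poly_prime[OF P] by (simp add: prime_elem_dvd_mult_iff)
  then show ?thesis
  proof
    assume "P dvd A"
    then show ?thesis by (rule quotient[OF AB pos(2)])
  next
    assume "P dvd B"
    moreover have "B * A = P * P" using AB by (simp add: mult.commute)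
    ultimately have "degree B = degree P" using pos(1) quotient by blast
    then show ?thesis using deg by simp
  qed
qed

text \<open>
  If \<open>P(w\<^sup>2, \<lambda>) = F G\<close>, the norms \<open>F(w, \<lambda>) F(- w, \<lambda>)\<close> and \<open>G(w, \<lambda>) G(- w, \<lambda>)\<close> are polynomials
  in \<open>w\<^sup>2\<close>, say \<open>A\<close> and \<open>B\<close> at \<open>t = w\<^sup>2\<close>, and \<open>A B = P\<^sup>2\<close>. As \<open>P\<close> is prime and neither \<open>A\<close> nor \<open>B\<close>
  is a unit, \<open>A\<close> is associated to \<open>P\<close>.
\<close>

theorem split_subst_square_of_irreducible:
  assumes P: "irreducible P" and p: "0 < p" "p < degree P" "monic_split p (subst_square P)"
  shows "2 * p = degree P"
proof -
  obtain F G where FG: "subst_square P = F * G" "lead_coeff F = 1" "lead_coeff G = 1" "degree F = p"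
    using p(3) unfolding monic_split_def by metis
  have nz: "F \<noteq> 0" "G \<noteq> 0" using FG by (simp_all add: monic_nonzero)
  have degG: "degree G = degree P - p"
  proof -
    have "degree P = degree (F * G)" by (simp only: FG(1)[symmetric] degree_subst_square)
    also have "\<dots> = p + degree G" using nz FG(4) by (simp add: degree_mult_eq)
    finally show ?thesis by simp
  qed
  have norm: "\<exists>A. subst_square A = H * reflect_inner H \<and> degree A = 2 * degree H"
    if H: "lead_coeff H = 1" for H
  proof -
    have "reflect_inner (H * reflect_inner H) = H * reflect_inner H"
      by (simp add: reflect_inner_mult reflect_inner_reflect_inner mult.commute)
    then obtain A where A: "subst_square A = H * reflect_inner H" using even_descent by metis
    have "degree A = degree (H * reflect_inner H)" unfolding A[symmetric] by (simp only: degree_subst_square)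
    also have "\<dots> = degree H + degree (reflect_inner H)"
      by (intro degree_mult_eq monic_nonzero H monic_reflect_inner)
    also have "\<dots> = 2 * degree H" by (simp add: monic_reflect_inner(1)[OF H])
    finally show ?thesis using A by blast
  qed
  obtain A where A: "subst_square A = F * reflect_inner F" "degree A = 2 * degree F"
    using norm[OF FG(2)] by (elim exE conjE)
  obtain B where B: "subst_square B = G * reflect_inner G" "degree B = 2 * degree G"
    using norm[OF FG(3)] by (elim exE conjE)
  have "subst_square (A * B) = (F * G) * reflect_inner (F * G)"
    unfolding subst_square_mult A(1) B(1) reflect_inner_mult by (simp only: mult.assoc mult.left_commute)
  also have "\<dots> = subst_square (P * P)"
    unfolding FG(1)[symmetric] reflect_inner_subst_square subst_square_mult ..
  finally have "A * B = P * P" unfolding subst_square_inject .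
  then have "degree A = degree P"
    by (rule square_of_prime_factor_degree[OF P]) (use A(2) B(2) FG(4) degG p in simp_all)
  then show ?thesis using A(2) FG(4) by simp
qed

lemma irreducible_continuant_of_chi:
  assumes n: "0 < n" and "irreducible (chi a c n)"
  shows "irreducible (continuant a c n)"
proof -
  have cont: "lead_coeff (continuant a c n) = 1" "degree (continuant a c n) = n"
    using continuant_monic by blast+
  have "monic_split p (continuant a c n) \<Longrightarrow> monic_split p (chi a c n)" for p
    unfolding chi_eq by (rule monic_split_subst_square)
  then show ?thesis
    using assms irreducible_iff_no_monic_split[OF cont(1)]
      irreducible_iff_no_monic_split[OF chi_monic(1), of a c n] cont(2) chi_monic(2)[of a c n]
    by metis
qed

lemma chi_split_half:
  assumes irr: "irreducible (continuant a c n)" and n: "0 < n" and red: "\<not> irreducible (chi a c n)"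
  shows "even n \<and> monic_split (n div 2) (chi a c n)"
proof -
  obtain p where p: "0 < p" "p < n" "monic_split p (chi a c n)"
    using red irreducible_iff_no_monic_split[OF chi_monic(1), of a c n] chi_monic(2)[of a c n] n by metis
  have "degree (continuant a c n) = n" using continuant_monic by blast
  then have "2 * p = n"
    using split_subst_square_of_irreducible[OF irr p(1)] p(2,3) unfolding chi_eq by simp
  then have "even n" "n div 2 = p" by auto
  then show ?thesis using p(3) by simp
qed

text \<open>
  For odd \<open>n\<close> irreducibility passes from the continuant to \<open>chi\<close>, because the factors of \<open>chi\<close>
  would have degree \<open>n / 2\<close>. For even \<open>n\<close>, if \<open>chi\<close> were always reducible, it would
  split into two factors of degree \<open>n / 2\<close> for a dense set of \<open>c\<close>, hence for all \<open>c\<close>. But cutting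
  off an end node leaves a path of odd length \<open>n - 1\<close>, where \<open>chi\<close> is irreducible for a suitable
  \<open>c\<close>; this excludes the type \<open>n / 2\<close>, as \<open>n \<ge> 4\<close>.
\<close>

theorem exists_irreducible_chi:
  assumes n: "3 \<le> n" and a: "\<not> alternating n a"
  shows "\<exists>c. irreducible (chi a c n)"
proof (rule ccontr)
  assume no: "\<not> (\<exists>c. irreducible (chi a c n))"
  have I: "{1..n - 1} \<subseteq> {..<n}" "0 < n" using n by auto
  obtain c0 where c0: "irreducible (continuant a c0 n)"
    using exists_irreducible_continuant[OF n a] ..
  then have even: "even n" using chi_split_half[of a c0 n] no I(2) by metis
  then have n4: "4 \<le> n" using n by presburger
  define D where "D = {c. irreducible (continuant a c n)}"
  have "zariski_dense {1..n - 1} D \<or> zariski_dense {1..n - 1} (- D)"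
  proof -
    have "\<exists>b\<in>UNIV. zariski_dense {1..n - 1} (if b then D else - D)"
      by (rule zariski_dense_finite_Union[OF zariski_dense_UNIV]) auto
    then show ?thesis by (metis (full_types))
  qed
  moreover have "\<not> zariski_dense {1..n - 1} (- D)"
  proof
    assume dense: "zariski_dense {1..n - 1} (- D)"
    have "\<exists>p. 0 < p \<and> p < n \<and> (\<forall>c. monic_split p (continuant a c n))"
      by (rule dense_reducible_uniform_split[OF continuant_family I dense]) (simp add: D_def)
    then obtain p where p: "0 < p" "p < n" "monic_split p (continuant a c0 n)" by auto
    have cont: "lead_coeff (continuant a c0 n) = 1" "degree (continuant a c0 n) = n"
      using continuant_monic by blast+
    show False using irreducible_iff_no_monic_split[OF cont(1)] cont(2) c0 p I(2) by auto
  qed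
  ultimately have D: "zariski_dense {1..n - 1} D" by blast
  have split: "monic_split (n div 2) (chi a c n)" for c
  proof (rule monic_split_closed[OF chi_family I _ D])
    fix c assume "c \<in> D"
    then have "irreducible (continuant a c n)" by (simp add: D_def)
    then show "monic_split (n div 2) (chi a c n)" using chi_split_half[of a c n] no I(2) by blast
  qed simp
  obtain a' where a': "a' = a \<or> a' = (\<lambda>i. a (1 + i))" "\<not> alternating (n - 1) a'"
    using alternating_of_subpaths[OF n4, of a] a by metis
  have "3 \<le> n - 1" using n4 by simp
  from exists_irreducible_continuant[OF this a'(2)]
  obtain c' where c': "irreducible (continuant a' c' (n - 1))" ..
  have "odd (n - 1)" using even n by simp
  then have chi': "irreducible (chi a' c' (n - 1))"
    using chi_split_half[OF c'] n by auto
  have "\<exists>c L. degree L = 1 \<and> lead_coeff L = 1 \<and> continuant a c n = L * continuant a' c' (n - 1)"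
    by (rule end_block_embedding[OF _ a'(1)]) (use n in simp)
  then obtain c L where L: "degree L = 1" "lead_coeff L = 1"
    "continuant a c n = L * continuant a' c' (n - 1)" by (elim exE conjE)
  have eq: "chi a c n = subst_square L * chi a' c' (n - 1)"
    unfolding chi_eq L(3) subst_square_mult ..
  have "degree (subst_square L) = 1" by (simp only: degree_subst_square L(1))
  moreover have "0 < n div 2" "n div 2 < n" using n by auto
  ultimately have "n div 2 = 1 \<or> n div 2 = n - 1"
    using split_type_of_large_irreducible_factor[OF chi', of "subst_square L" "n div 2"]
      split[of c] chi_monic[of a c n] unfolding eq by (simp only: simp_thms)
  then show False using n4 by presburger
qed

section \<open>Alternating diagonals\<close>

lemma alternating_iff:
  "alternating n a \<longleftrightarrow> (\<forall>i. 1 \<le> i \<and> i \<le> n \<and> (odd i \<or> even n) \<longrightarrow> a i = (if odd i then a 1 else a 2))"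
proof
  assume alt: "alternating n a"
  show "\<forall>i. 1 \<le> i \<and> i \<le> n \<and> (odd i \<or> even n) \<longrightarrow> a i = (if odd i then a 1 else a 2)"
  proof (intro allI impI)
    fix i :: nat
    assume "1 \<le> i \<and> i \<le> n \<and> (odd i \<or> even n)"
    then show "a i = (if odd i then a 1 else a 2)"
    proof (induction i rule: less_induct)
      case (less i)
      show ?case
      proof (cases "i \<le> 2")
        case True
        then have "i = 1 \<or> i = 2" using less.prems by auto
        then show ?thesis by auto
      next
        case False
        define k where "k = i - 2"
        have i: "i = k + 2" using False by (simp add: k_def)
        have k: "1 \<le> k" "k + 2 \<le> n" "odd k \<or> even n" using less.prems False unfolding i by auto
        then have "a (k + 2) = a k" using alt unfolding alternating_def by blast
        moreover have "a k = (if odd k then a 1 else a 2)"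
          using less.IH[of k] k unfolding i by simp
        ultimately show ?thesis unfolding i by simp
      qed
    qed
  qed
next
  assume *: "\<forall>i. 1 \<le> i \<and> i \<le> n \<and> (odd i \<or> even n) \<longrightarrow> a i = (if odd i then a 1 else a 2)"
  show "alternating n a"
    unfolding alternating_def
  proof (intro allI impI)
    fix i assume i: "1 \<le> i \<and> i + 2 \<le> n \<and> (odd i \<or> even n)"
    then have "a i = (if odd i then a 1 else a 2)" "a (i + 2) = (if odd (i + 2) then a 1 else a 2)"
      using *[rule_format, of i] *[rule_format, of "i + 2"] by simp_all
    then show "a (i + 2) = a i" by simp
  qed
qed

text \<open>
  At \<open>\<lambda> = - \<alpha>\<close> the matrix links the odd positions only to the fewer even ones, so it is
  singular.
\<close>

lemma odd_continuant_root:
  assumes "\<And>i. i \<le> m \<Longrightarrow> a (2 * i + 1) = \<alpha>"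
  shows "poly (continuant a c (2 * m + 1)) [:- \<alpha>:] = 0"
  using assms
proof (induction m)
  case 0
  then show ?case using "0.prems"[of 0] by simp
next
  case (Suc m)
  have "continuant a c (2 * Suc m + 1) =
      [:[:a (2 * Suc m + 1):], 1:] * continuant a c (2 * m + 2)
        - Polynomial.smult [:0, c (2 * m + 2):] (continuant a c (2 * m + 1))"
    by simp
  moreover have "poly [:[:a (2 * Suc m + 1):], 1:] [:- \<alpha>:] = 0"
    using Suc.prems[of "Suc m"] by simp
  moreover have "poly (continuant a c (2 * m + 1)) [:- \<alpha>:] = 0"
    using Suc.prems by (intro Suc.IH) simp
  ultimately show ?case
    by (simp only: poly_diff poly_mult poly_smult mult_zero_left mult_zero_right diff_self)
qed

text \<open>
  For a diagonal with period two, the continuant of even length is a form in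
  \<open>S = (\<lambda> + \<alpha>) (\<lambda> + \<beta>)\<close> and \<open>t\<close>, and so is the one of odd length after division by \<open>\<lambda> + \<alpha>\<close>. The
  polynomials \<open>g\<close> and \<open>h\<close> are these forms at \<open>t = 1\<close>. Instead of homogenizing them, the
  lemma records the forms modulo \<open>S - \<sigma> t\<close>: a root \<open>\<sigma>\<close> of \<open>g\<close> yields the factor \<open>S - \<sigma> t\<close>.
\<close>

lemma even_continuant_pencil:
  fixes \<alpha> \<beta> :: complex
  assumes a: "\<And>i. a i = (if odd i then \<alpha> else \<beta>)"
  defines "S \<equiv> [:[:\<alpha>:], 1:] * [:[:\<beta>:], 1:]" and "T \<equiv> [:0, 1:] :: complex poly"
  shows "\<exists>g h B. degree g = m \<and> lead_coeff g = 1 \<and> degree h = m \<and> lead_coeff h = 1 \<and>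
     continuant a c (2 * m + 1) = [:[:\<alpha>:], 1:] * B \<and>
     (\<forall>\<sigma>. S - [:Polynomial.smult \<sigma> T:] dvd continuant a c (2 * m) - [:Polynomial.smult (poly g \<sigma>) (T ^ m):]) \<and>
     (\<forall>\<sigma>. S - [:Polynomial.smult \<sigma> T:] dvd B - [:Polynomial.smult (poly h \<sigma>) (T ^ m):])"
proof (induction m)
  case 0
  show ?case using a[of 1] by (intro exI[of _ 1] conjI allI) simp_all
next
  case (Suc m)
  then obtain g h B where gh: "degree g = m" "lead_coeff g = 1" "degree h = m" "lead_coeff h = 1"
    and B: "continuant a c (2 * m + 1) = [:[:\<alpha>:], 1:] * B"
    and dvdA: "\<And>\<sigma>. S - [:Polynomial.smult \<sigma> T:] dvd continuant a c (2 * m) - [:Polynomial.smult (poly g \<sigma>) (T ^ m):]"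
    and dvdB: "\<And>\<sigma>. S - [:Polynomial.smult \<sigma> T:] dvd B - [:Polynomial.smult (poly h \<sigma>) (T ^ m):]"
    by (elim exE conjE) blast
  define c1 c2 where "c1 = c (2 * m + 1)" and "c2 = c (2 * m + 2)"
  define A A' B' where "A = continuant a c (2 * m)" and "A' = continuant a c (2 * m + 2)"
    and "B' = A' - [:Polynomial.smult c2 T:] * B"
  define g' where "g' = pCons 0 h - Polynomial.smult c1 g"
  define h' where "h' = g' - Polynomial.smult c2 h"
  have g': "degree g' = Suc m" "lead_coeff g' = 1"
  proof -
    have "h \<noteq> 0" using gh(4) by (rule monic_nonzero)
    then have "degree (pCons 0 h) = Suc m" "coeff (pCons 0 h) (Suc m) = 1" using gh by simp_all
    moreover have "degree (Polynomial.smult c1 g) < Suc m"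
      using degree_smult_le[of c1 g] gh(1) by simp
    moreover have "coeff g (Suc m) = 0" by (rule coeff_eq_0) (simp add: gh)
    ultimately have 1: "coeff g' (Suc m) = 1" and "degree g' \<le> Suc m"
      unfolding g'_def by (simp_all add: degree_diff_le)
    then show "degree g' = Suc m" by (metis le_antisym le_degree zero_neq_one)
    then show "lead_coeff g' = 1" using 1 by simp
  qed
  have h': "degree h' = Suc m" "lead_coeff h' = 1"
  proof -
    have small: "degree (Polynomial.smult c2 h) < Suc m"
      using degree_smult_le[of c2 h] gh(3) by simp
    moreover have "coeff h (Suc m) = 0" by (rule coeff_eq_0) (simp add: gh)
    ultimately have 1: "coeff h' (Suc m) = 1" and "degree h' \<le> Suc m"
      unfolding h'_def using g' by (simp_all add: degree_diff_le)
    then show "degree h' = Suc m" by (metis le_antisym le_degree zero_neq_one)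
    then show "lead_coeff h' = 1" using 1 by simp
  qed
  have smult_const: "Polynomial.smult [:0, x:] P = [:Polynomial.smult x T:] * P" for x and P :: "complex poly poly"
    by (simp add: T_def)
  have A'_eq: "A' = S * B - [:Polynomial.smult c1 T:] * A"
  proof -
    have "A' = [:[:\<beta>:], 1:] * continuant a c (2 * m + 1) - Polynomial.smult [:0, c1:] A"
      using a[of "2 * m + 2"] by (simp add: A'_def A_def c1_def)
    then show ?thesis unfolding B S_def smult_const by (simp only: mult.assoc mult.left_commute)
  qed
  have B'_eq: "continuant a c (2 * Suc m + 1) = [:[:\<alpha>:], 1:] * B'"
  proof -
    have "continuant a c (2 * Suc m + 1) =
        [:[:\<alpha>:], 1:] * A' - Polynomial.smult [:0, c2:] (continuant a c (2 * m + 1))"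
      using a[of "2 * Suc m + 1"] by (simp add: A'_def c2_def)
    then show ?thesis
      unfolding B B'_def smult_const right_diff_distrib by (simp only: mult.left_commute)
  qed
  have dvdA': "S - [:Polynomial.smult \<sigma> T:] dvd A' - [:Polynomial.smult (poly g' \<sigma>) (T ^ Suc m):]" for \<sigma>
  proof -
    define U V G H where "U = [:Polynomial.smult \<sigma> T:]" and "V = [:Polynomial.smult c1 T:]"
      and "G = [:Polynomial.smult (poly g \<sigma>) (T ^ m):]" and "H = [:Polynomial.smult (poly h \<sigma>) (T ^ m):]"
    have "[:Polynomial.smult (poly g' \<sigma>) (T ^ Suc m):] = U * H - V * G"
      by (simp add: g'_def U_def V_def G_def H_def smult_diff_left mult.commute)
    then have "A' - [:Polynomial.smult (poly g' \<sigma>) (T ^ Suc m):] =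
        (S - U) * B + U * (B - H) - V * (A - G)"
      unfolding A'_eq by (simp add: algebra_simps V_def[symmetric])
    moreover have "S - U dvd (S - U) * B + U * (B - H) - V * (A - G)"
      unfolding U_def G_def H_def A_def
      by (intro dvd_diff dvd_add dvd_mult dvdA dvdB dvd_triv_left)
    ultimately show ?thesis by (simp only: U_def)
  qed
  have dvdB': "S - [:Polynomial.smult \<sigma> T:] dvd B' - [:Polynomial.smult (poly h' \<sigma>) (T ^ Suc m):]" for \<sigma>
  proof -
    define W G H where "W = [:Polynomial.smult c2 T:]"
      and "G = [:Polynomial.smult (poly g' \<sigma>) (T ^ Suc m):]" and "H = [:Polynomial.smult (poly h \<sigma>) (T ^ m):]"
    have const: "[:Polynomial.smult (poly h' \<sigma>) (T ^ Suc m):] = G - W * H"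
      by (simp add: h'_def W_def G_def H_def smult_diff_left mult.commute)
    have "B' - [:Polynomial.smult (poly h' \<sigma>) (T ^ Suc m):] = (A' - G) - W * (B - H)"
      unfolding const B'_def W_def[symmetric] by (simp add: algebra_simps)
    moreover have "S - [:Polynomial.smult \<sigma> T:] dvd (A' - G) - W * (B - H)"
      unfolding G_def H_def by (intro dvd_diff dvd_mult dvdA' dvdB)
    ultimately show ?thesis by (simp only:)
  qed
  have "A' = continuant a c (2 * Suc m)" by (simp add: A'_def)
  with dvdA' have dvdA'': "\<forall>\<sigma>. S - [:Polynomial.smult \<sigma> T:] dvd
      continuant a c (2 * Suc m) - [:Polynomial.smult (poly g' \<sigma>) (T ^ Suc m):]" by (simp only:) simp
  show ?case
    by (rule exI[of _ g'], rule exI[of _ h'], rule exI[of _ B'])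
      (intro conjI g' h' B'_eq dvdA'' allI dvdB')
qed

text \<open>
  The factor is \<open>\<lambda> + a\<^sub>1\<close> for odd \<open>n\<close>. For even \<open>n\<close> it is \<open>(\<lambda> + a\<^sub>1) (\<lambda> + a\<^sub>2) - \<sigma> t\<close>, a proper
  factor as \<open>n \<ge> 4\<close>.
\<close>

lemma alternating_imp_reducible_continuant:
  assumes n: "3 \<le> n" and alt: "alternating n a"
  shows "\<exists>p. 0 < p \<and> p < n \<and> monic_split p (continuant a c n)"
proof (cases "even n")
  case False
  then obtain m where m: "n = 2 * m + 1" by (rule oddE)
  have "a (2 * i + 1) = a 1" if "i \<le> m" for i
    using alt[unfolded alternating_iff, rule_format, of "2 * i + 1"] that by (simp add: m)
  then have "poly (continuant a c n) [:- a 1:] = 0" unfolding m by (rule odd_continuant_root)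
  then have "[:- [:- a 1:], 1:] dvd continuant a c n" by (simp only: poly_eq_0_iff_dvd)
  then have "monic_split (degree [:- [:- a 1:], 1:]) (continuant a c n)"
    by (intro monic_split_of_dvd conjunct2[OF continuant_monic]) simp_all
  then show ?thesis using n by (intro exI[of _ 1]) simp
next
  case True
  then obtain m where m: "n = 2 * m" by (rule evenE)
  define a' where "a' i = (if odd i then a 1 else a 2)" for i :: nat
  have cong: "continuant a c n = continuant a' c (2 * m)"
    unfolding m[symmetric]
    using alt True unfolding alternating_iff a'_def by (intro continuant_cong) auto
  define S T where "S = [:[:a 1:], 1:] * [:[:a 2:], 1:]" and "T = ([:0, 1:] :: complex poly)"
  obtain g where g: "degree g = m"
    and dvd: "\<And>\<sigma>. S - [:Polynomial.smult \<sigma> T:] dvd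
        continuant a' c (2 * m) - [:Polynomial.smult (poly g \<sigma>) (T ^ m):]"
    using even_continuant_pencil[of a' "a 1" "a 2" m c] unfolding S_def T_def a'_def by blast
  have "\<not> constant (poly g)" using g m n by (simp add: constant_degree)
  then have "\<exists>\<sigma>. poly g \<sigma> = 0" by (rule fundamental_theorem_of_algebra)
  then obtain \<sigma> where \<sigma>: "poly g \<sigma> = 0" ..
  have F: "S - [:Polynomial.smult \<sigma> T:] = [:[:a 1 * a 2:] - Polynomial.smult \<sigma> T, [:a 1 + a 2:], 1:]"
    by (simp add: S_def)
  have "S - [:Polynomial.smult \<sigma> T:] dvd continuant a c n"
    using dvd[of \<sigma>] unfolding \<sigma> cong by simp
  then have "monic_split (degree [:[:a 1 * a 2:] - Polynomial.smult \<sigma> T, [:a 1 + a 2:], 1:]) (continuant a c n)"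
    unfolding F by (intro monic_split_of_dvd conjunct2[OF continuant_monic]) simp_all
  then show ?thesis using n m by (intro exI[of _ "Suc (Suc 0)"]) auto
qed

lemma alternating_imp_reducible:
  assumes n: "3 \<le> n" and alt: "alternating n a"
  shows "\<not> irreducible (continuant a c n)" "\<not> irreducible (chi a c n)"
proof -
  obtain p where p: "0 < p" "p < n" "monic_split p (continuant a c n)"
    using alternating_imp_reducible_continuant[OF assms] by blast
  have cont: "lead_coeff (continuant a c n) = 1" "degree (continuant a c n) = n"
    using continuant_monic by blast+
  show "\<not> irreducible (continuant a c n)"
    using irreducible_iff_no_monic_split[OF cont(1)] cont(2) p by auto
  then show "\<not> irreducible (chi a c n)"
    using irreducible_continuant_of_chi[of n a c] n by auto
qed

lemma generic_irreducibility_classification: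
  assumes n: "3 \<le> n"
  shows "for_generic_c n (\<lambda>c. irreducible (continuant a c n)) \<longleftrightarrow> \<not> alternating n a"
    "for_generic_c n (\<lambda>c. irreducible (chi a c n)) \<longleftrightarrow> \<not> alternating n a"
    "for_generic_c n (\<lambda>c. \<not> irreducible (chi a c n)) \<longleftrightarrow> alternating n a"
proof -
  have n0: "0 < n" using n by simp
  have P: "for_generic_c n (\<lambda>c. irreducible (continuant a c n))" if "\<not> alternating n a"
  proof -
    obtain c where "irreducible (continuant a c n)"
      using exists_irreducible_continuant[OF n \<open>\<not> alternating n a\<close>] ..
    then show ?thesis by (rule generic_irreducible_of_point[OF continuant_family n0])
  qed
  have chi: "for_generic_c n (\<lambda>c. irreducible (chi a c n))" if "\<not> alternating n a"
  proof -
    obtain c where "irreducible (chi a c n)"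
      using exists_irreducible_chi[OF n \<open>\<not> alternating n a\<close>] ..
    then show ?thesis by (rule generic_irreducible_of_point[OF chi_family n0])
  qed
  have redP: "for_generic_c n (\<lambda>c. \<not> irreducible (continuant a c n))" if "alternating n a"
    by (rule generic_of_all) (rule alternating_imp_reducible[OF n that])
  have red_chi: "for_generic_c n (\<lambda>c. \<not> irreducible (chi a c n))" if "alternating n a"
    by (rule generic_of_all) (rule alternating_imp_reducible[OF n that])
  show "for_generic_c n (\<lambda>c. irreducible (continuant a c n)) \<longleftrightarrow> \<not> alternating n a"
    using P redP generic_not_contradictory by blast
  show "for_generic_c n (\<lambda>c. irreducible (chi a c n)) \<longleftrightarrow> \<not> alternating n a"
    using chi red_chi generic_not_contradictory by blast
  show "for_generic_c n (\<lambda>c. \<not> irreducible (chi a c n)) \<longleftrightarrow> alternating n a"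
    using chi red_chi generic_not_contradictory by blast
qed

lemma alternating_odd:
  "alternating (2 * m + 1) a \<longleftrightarrow> (\<forall>i\<in>{0..m}. a (2 * i + 1) = a 1)"
proof
  assume alt: "alternating (2 * m + 1) a"
  show "\<forall>i\<in>{0..m}. a (2 * i + 1) = a 1"
    using alt[unfolded alternating_iff, rule_format, of "2 * _ + 1"] by simp
next
  assume *: "\<forall>i\<in>{0..m}. a (2 * i + 1) = a 1"
  show "alternating (2 * m + 1) a"
    unfolding alternating_iff
  proof (intro allI impI)
    fix j assume j: "1 \<le> j \<and> j \<le> 2 * m + 1 \<and> (odd j \<or> even (2 * m + 1))"
    then have "odd j" by simp
    then obtain i where i: "j = 2 * i + 1" by (rule oddE)
    then have "i \<in> {0..m}" using j by simp
    then have "a (2 * i + 1) = a 1" using * by blast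
    then show "a j = (if odd j then a 1 else a 2)" unfolding i by simp
  qed
qed

lemma alternating_even:
  "alternating (2 * m) a \<longleftrightarrow>
     (\<forall>i\<in>{1..m}. a (2 * i - 1) = a 1) \<and> (\<forall>i\<in>{1..m}. a (2 * i) = a 2)"
proof
  assume alt: "alternating (2 * m) a"
  have "a (2 * i - 1) = a 1" "a (2 * i) = a 2" if "i \<in> {1..m}" for i
  proof -
    have "odd (2 * i - 1)" "1 \<le> 2 * i - 1" "2 * i - 1 \<le> 2 * m" using that by auto
    then show "a (2 * i - 1) = a 1"
      using alt[unfolded alternating_iff, rule_format, of "2 * i - 1"] by simp
    show "a (2 * i) = a 2"
      using alt[unfolded alternating_iff, rule_format, of "2 * i"] that by auto
  qed
  then show "(\<forall>i\<in>{1..m}. a (2 * i - 1) = a 1) \<and> (\<forall>i\<in>{1..m}. a (2 * i) = a 2)" by blast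
next
  assume *: "(\<forall>i\<in>{1..m}. a (2 * i - 1) = a 1) \<and> (\<forall>i\<in>{1..m}. a (2 * i) = a 2)"
  show "alternating (2 * m) a"
    unfolding alternating_iff
  proof (intro allI impI)
    fix j assume j: "1 \<le> j \<and> j \<le> 2 * m \<and> (odd j \<or> even (2 * m))"
    show "a j = (if odd j then a 1 else a 2)"
    proof (cases "odd j")
      case True
      then obtain i where i: "j = 2 * i + 1" by (rule oddE)
      then have "i + 1 \<in> {1..m}" using j by simp
      then have "a (2 * (i + 1) - 1) = a 1" using * by blast
      then show ?thesis using i by simp
    next
      case False
      then obtain i where i: "j = 2 * i" by auto
      then have "i \<in> {1..m}" using j by simp
      then have "a (2 * i) = a 2" using * by blast
      then show ?thesis using i by simp
    qed
  qed
qed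

theorem corollary6p4:
  fixes n :: nat and a :: "nat \<Rightarrow> complex"
  assumes "n \<ge> 3"
  shows "(for_generic_c n (\<lambda>c. irreducible (chi a c n)) \<longleftrightarrow>
            for_generic_c n (\<lambda>c. irreducible (continuant a c n)))
       \<and> (\<forall>m. n = 2 * m + 1 \<longrightarrow>
            (for_generic_c n (\<lambda>c. \<not> irreducible (chi a c n)) \<longleftrightarrow>
              (\<forall>i\<in>{0..m}. a (2 * i + 1) = a 1)))
       \<and> (\<forall>m. n = 2 * m \<longrightarrow>
            (for_generic_c n (\<lambda>c. \<not> irreducible (chi a c n)) \<longleftrightarrow>
              (\<forall>i\<in>{1..m}. a (2 * i - 1) = a 1) \<and> (\<forall>i\<in>{1..m}. a (2 * i) = a 2)))"
proof (intro conjI allI impI)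
  show "for_generic_c n (\<lambda>c. irreducible (chi a c n)) \<longleftrightarrow>
      for_generic_c n (\<lambda>c. irreducible (continuant a c n))"
    unfolding generic_irreducibility_classification[OF assms] ..
next
  fix m assume "n = 2 * m + 1"
  then show "for_generic_c n (\<lambda>c. \<not> irreducible (chi a c n)) \<longleftrightarrow>
      (\<forall>i\<in>{0..m}. a (2 * i + 1) = a 1)"
    using generic_irreducibility_classification(3)[OF assms, of a] alternating_odd[of m a] by simp
next
  fix m assume "n = 2 * m"
  then show "for_generic_c n (\<lambda>c. \<not> irreducible (chi a c n)) \<longleftrightarrow>
      (\<forall>i\<in>{1..m}. a (2 * i - 1) = a 1) \<and> (\<forall>i\<in>{1..m}. a (2 * i) = a 2)"
    using generic_irreducibility_classification(3)[OF assms, of a] alternating_even[of m a] by simp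
qed

end
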